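(* Let $p\ge1$ be an integer. For continuous interpolation of order $p$, if $u\in C^{p+1}(D)$ with the $(p+1)$-th derivative of $u$ bounded (and, in the case $p=1$, $u\in C^3(D)$ with $u_{xxx}$ bounded), then for the linearized peridynamic force $$\sup_{i\in K}\big|-\nabla PD_l^\epsilon(\mathcal{I}_h[u])(x_i)-\mathbb{C}u_{xx}(x_i)\big|=O(\epsilon)+O(h^p/\epsilon),$$ and for the nonlinear peridynamic force $$\sup_{i\in K}\big|-\nabla PD^\epsilon(\mathcal{I}_h[u])(x_i)-\mathbb{C}u_{xx}(x_i)\big|=O(\epsilon)+O(h^p/\epsilon).$$ Moreover, let $\bar p=\max\{p+1,4\}$. In the case of linearized peridynamics, if $u\in C^{\bar p}(D)$ is such that the $\bar p$-th derivative of $u$ is bounded, then $$\sup_{i\in K}\big|-\nabla PD_l^\epsilon(\mathcal{I}_h[u])(x_i)-\mathbb{C}u_{xx}(x_i)\big|=O(\epsilon^2)+O(h^p/\epsilon).$$ Here $O(\epsilon^k)+O(h^p/\epsilon)$ means bounded by $C(\epsilon^k+h^p/\epsilon)$ with $C$ independent of $h$, $\epsilon$ and $i$.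
   Context: $D=[a,b]\subset\mathbb{R}$ is a bounded interval, $\epsilon>0$ is the horizon, and $\partial D^\epsilon=(a-\epsilon,a+\epsilon)\cup(b-\epsilon,b+\epsilon)$ is the nonlocal boundary. $C^n(D)$ is the space of functions with $n$ continuous derivatives on $D$. In this setting, nonlocal displacements have zero boundary values on $\partial D^\epsilon$, and the local elastodynamic displacement is extended by zero outside $D$. The strain is $S(y,x;u)=\frac{u(y)-u(x)}{|y-x|}$. The function $f:[0,\infty)\to\mathbb{R}$ is positive (for $r>0$), smooth and concave with $\lim_{r\to0^+}f(r)/r=f'(0)$ and $\lim_{r\to\infty}f(r)=f_\infty<\infty$, and $f'',f''',f''''$ are bounded on $(0,\infty)$. The influence function $J(|\xi|)$ is zero for $\xi$ outside $[-1,1]$ and satisfies $0\le J(|\xi|)\le M$ on $[-1,1]$. The nonlinear and linearized peridynamic forces are $$-\nabla PD^\epsilon(u)(x)=\frac{2}{\epsilon^2}\int_{x-\epsilon}^{x+\epsilon}J(|y-x|/\epsilon)f'\big(|y-x|S(y,x;u)^2\big)S(y,x;u)\,dy,$$ $$-\nabla PD_l^\epsilon(u)(x)=\frac{2}{\epsilon^2}\int_{x-\epsilon}^{x+\epsilon}J(|y-x|/\epsilon)f'(0)S(y,x;u)\,dy ,$$ and $\mathbb{C}=\int_{-1}^1J(|z|)f'(0)|z|\,dz$. Mesh: $h>0$ is the mesh (element) size and $p$ the order of interpolation; the grid points are $x_i=ih/p$, $K=\{i\in\mathbb{Z}:ih/p\in\overline D\}$, $K^\epsilon=\{i\in\mathbb{Z}:ih/p\in\overline{\partial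 D^\epsilon}\}$. The elements are the intervals $[kh,(k+1)h]$, $k\in\mathbb{Z}$; $\overline D$ and $\overline{\partial D^\epsilon}$ contain an integral number of elements and $\epsilon=mh$ with $m$ a positive integer (both $\epsilon$ and $h$ may decrease). For a function $g:\overline{D\cup\partial D^\epsilon}\to\mathbb{R}$, $\mathcal{I}_h[g]$ is the continuous local Lagrange interpolant of order $p$: on each element contained in $\overline{D\cup\partial D^\epsilon}$ it is the polynomial of degree at most $p$ agreeing with $g$ at the $p+1$ grid points of that element.
   Formalization: The extension of u by zero outside D is additionally assumed to be C^2 on the real line for the O(ε) claims and C^3 for the O(ε^2) claim; without this the claims fail at the endpoints (e.g. u(x)=x(1-x) on [0,1]). J is assumed Lebesgue measurable. *)

theory Defs
  imports "HOL-Analysis.Analysis" "HOL-Computational_Algebra.Polynomial"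
begin

text \<open>Derivatives are taken relative to a set \<open>S\<close>, hence one-sided at the end points
  of a closed interval. \<open>C_on S n u\<close> says that \<open>u\<close> has \<open>n\<close> continuous derivatives on \<open>S\<close>.\<close>

definition nth_deriv_on :: "real set \<Rightarrow> nat \<Rightarrow> (real \<Rightarrow> real) \<Rightarrow> real \<Rightarrow> real" where
  "nth_deriv_on S n u = ((\<lambda>g x. vector_derivative g (at x within S)) ^^ n) u"

definition C_on :: "real set \<Rightarrow> nat \<Rightarrow> (real \<Rightarrow> real) \<Rightarrow> bool" where
  "C_on S n u \<longleftrightarrow>
     (\<forall>k<n. \<forall>x\<in>S. (nth_deriv_on S k u has_real_derivative nth_deriv_on S (Suc k) u x) (at x within S)) \<and>
     continuous_on S (nth_deriv_on S n u)"

text \<open>Displacements are extended by zero outside \<open>D = [a,b]\<close>. Regularity of \<open>u\<close> on \<open>D\<close> does not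
  by itself make this extension regular across \<open>a\<close> and \<open>b\<close>: if \<open>u(a) = 0\<close> and \<open>u'(a) \<noteq> 0\<close>, the
  force at \<open>a\<close> is in general of size \<open>1/\<epsilon>\<close>. It does if \<open>u\<close> also vanishes on the nonlocal
  boundary for some horizon. Regularity of the extension is therefore a separate hypothesis.\<close>

definition zero_ext :: "real \<Rightarrow> real \<Rightarrow> (real \<Rightarrow> real) \<Rightarrow> real \<Rightarrow> real" where
  "zero_ext a b u x = (if x \<in> {a..b} then u x else 0)"

definition nonlocal_boundary :: "real \<Rightarrow> real \<Rightarrow> real \<Rightarrow> real set" where
  "nonlocal_boundary a b \<epsilon> = {a - \<epsilon><..<a + \<epsilon>} \<union> {b - \<epsilon><..<b + \<epsilon>}"

text \<open>Since \<open>x / 0 = 0\<close>, the strain is \<open>0\<close> at \<open>y = x\<close>; this affects the integrals below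
  only on a null set.\<close>

definition strain :: "(real \<Rightarrow> real) \<Rightarrow> real \<Rightarrow> real \<Rightarrow> real" where
  "strain u y x = (u y - u x) / \<bar>y - x\<bar>"

text \<open>\<open>pd_force\<close> and \<open>pd_force_lin\<close> are the forces with their sign, that is
  \<open>-\<nabla>PD\<^sup>\<epsilon>\<close> and \<open>-\<nabla>PD\<^sub>l\<^sup>\<epsilon>\<close>. The potential \<open>f\<close> lives on \<open>[0,\<infinity>)\<close>, so \<open>f'(0)\<close> is the right
  derivative.\<close>

definition pd_force :: "(real \<Rightarrow> real) \<Rightarrow> (real \<Rightarrow> real) \<Rightarrow> real \<Rightarrow> (real \<Rightarrow> real) \<Rightarrow> real \<Rightarrow> real" where
  "pd_force J f \<epsilon> u x =
     2 / \<epsilon>\<^sup>2 * (LINT y:{x - \<epsilon>..x + \<epsilon>}|lebesgue.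
       J (\<bar>y - x\<bar> / \<epsilon>) * nth_deriv_on {0..} 1 f (\<bar>y - x\<bar> * (strain u y x)\<^sup>2) * strain u y x)"

definition pd_force_lin :: "(real \<Rightarrow> real) \<Rightarrow> (real \<Rightarrow> real) \<Rightarrow> real \<Rightarrow> (real \<Rightarrow> real) \<Rightarrow> real \<Rightarrow> real" where
  "pd_force_lin J f \<epsilon> u x =
     2 / \<epsilon>\<^sup>2 * (LINT y:{x - \<epsilon>..x + \<epsilon>}|lebesgue.
       J (\<bar>y - x\<bar> / \<epsilon>) * nth_deriv_on {0..} 1 f 0 * strain u y x)"

definition elastic_modulus :: "(real \<Rightarrow> real) \<Rightarrow> (real \<Rightarrow> real) \<Rightarrow> real" where
  "elastic_modulus J f = (LINT z:{-1..1}|lebesgue. J \<bar>z\<bar> * nth_deriv_on {0..} 1 f 0 * \<bar>z\<bar>)"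

definition grid_pt :: "real \<Rightarrow> nat \<Rightarrow> int \<Rightarrow> real" where
  "grid_pt h p i = of_int i * h / of_nat p"

definition grid_indices :: "real \<Rightarrow> nat \<Rightarrow> real \<Rightarrow> real \<Rightarrow> int set" where
  "grid_indices h p a b = {i. grid_pt h p i \<in> closure {a..b}}"

definition mesh_elem :: "real \<Rightarrow> int \<Rightarrow> real set" where
  "mesh_elem h k = {of_int k * h..of_int (k + 1) * h}"

definition union_of_elems :: "real \<Rightarrow> real set \<Rightarrow> bool" where
  "union_of_elems h S \<longleftrightarrow> (\<exists>ks. S = (\<Union>k\<in>ks. mesh_elem h k))"

definition admissible_mesh :: "real \<Rightarrow> real \<Rightarrow> real \<Rightarrow> real \<Rightarrow> bool" where
  "admissible_mesh a b h \<epsilon> \<longleftrightarrow>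
     h > 0 \<and> (\<exists>m::nat. m > 0 \<and> \<epsilon> = of_nat m * h) \<and>
     union_of_elems h (closure {a..b}) \<and> union_of_elems h (closure (nonlocal_boundary a b \<epsilon>))"

text \<open>The grid points of the element \<open>[kh,(k+1)h]\<close> are those with index \<open>kp, ..., kp+p\<close>.\<close>

definition elem_interp_poly :: "real \<Rightarrow> nat \<Rightarrow> (real \<Rightarrow> real) \<Rightarrow> int \<Rightarrow> real poly" where
  "elem_interp_poly h p g k =
     (THE q. degree q \<le> p \<and>
        (\<forall>j\<le>p. poly q (grid_pt h p (k * int p + int j)) = g (grid_pt h p (k * int p + int j))))"

text \<open>The element containing \<open>x\<close> has index \<open>\<lfloor>x / h\<rfloor>\<close>; at a point shared by two elements
  both interpolation polynomials have the value of \<open>g\<close>, see \<open>lagrange_interp_on_elem\<close> below.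
  Elements outside the region of interest are harmless: the values of the interpolant on a union
  of elements depend only on the values of \<open>g\<close> on that union.\<close>

definition lagrange_interp :: "real \<Rightarrow> nat \<Rightarrow> (real \<Rightarrow> real) \<Rightarrow> real \<Rightarrow> real" where
  "lagrange_interp h p g x = poly (elem_interp_poly h p g \<lfloor>x / h\<rfloor>) x"

lemma grid_pt_inj:
  assumes "h > 0" "p \<ge> 1" "grid_pt h p i = grid_pt h p j"
  shows "i = j"
  using assms by (simp add: grid_pt_def)

lemma elem_interp_poly_ex1:
  assumes "h > 0" "p \<ge> 1"
  shows "\<exists>!q::real poly. degree q \<le> p \<and>
    (\<forall>j\<le>p. poly q (grid_pt h p (k * int p + int j)) = g (grid_pt h p (k * int p + int j)))"
proof -
  define X where "X j = grid_pt h p (k * int p + int j)" for j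
  have inj: "X i = X j \<longleftrightarrow> i = j" for i j
    using grid_pt_inj[OF assms, of "k * int p + int i" "k * int p + int j"] by (auto simp: X_def)
  define w where "w j = (\<Prod>l\<in>{..p} - {j}. [:- X l, 1:])" for j
  define q where "q = (\<Sum>j\<le>p. smult (g (X j) / poly (w j) (X j)) (w j))"
  have deg_w: "degree (w j) \<le> p" if "j \<le> p" for j
  proof -
    have "degree (w j) \<le> sum (degree \<circ> (\<lambda>l. [:- X l, 1:])) ({..p} - {j})"
      unfolding w_def by (intro degree_prod_sum_le) auto
    also have "\<dots> = p" using that by simp
    finally show ?thesis .
  qed
  have w0: "poly (w j) (X i) = 0" if "i \<le> p" "i \<noteq> j" for i j
    using that by (auto simp: w_def poly_prod)
  have w1: "poly (w j) (X j) \<noteq> 0" for j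
    by (auto simp: w_def poly_prod inj)
  have val: "poly q (X i) = g (X i)" if "i \<le> p" for i
  proof -
    have "poly q (X i) = (\<Sum>j\<le>p. if j = i then g (X i) else 0)"
      unfolding q_def poly_sum using w0 w1 that by (intro sum.cong) auto
    also have "\<dots> = g (X i)" using that by simp
    finally show ?thesis .
  qed
  have deg: "degree q \<le> p"
    unfolding q_def by (intro degree_sum_le) (use deg_w in \<open>auto intro: order_trans[OF degree_smult_le]\<close>)
  have uniq: "q1 = q2"
    if "degree q1 \<le> p" "degree q2 \<le> p"
      "\<forall>j\<le>p. poly q1 (X j) = g (X j)" "\<forall>j\<le>p. poly q2 (X j) = g (X j)" for q1 q2 :: "real poly"
  proof (rule poly_eqI_degree[where A = "X ` {..p}"])
    have "card (X ` {..p}) = Suc p"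
      using inj by (subst card_image) (auto simp: inj_on_def)
    then show "card (X ` {..p}) > degree q1" "card (X ` {..p}) > degree q2"
      using that by auto
  qed (use that in auto)
  show ?thesis
    unfolding X_def[symmetric] using deg val uniq by (intro ex1I[of _ q]) blast+
qed

lemma elem_interp_poly:
  assumes "h > 0" "p \<ge> 1"
  shows "degree (elem_interp_poly h p g k) \<le> p"
    and "j \<le> p \<Longrightarrow> poly (elem_interp_poly h p g k) (grid_pt h p (k * int p + int j))
                     = g (grid_pt h p (k * int p + int j))"
  using theI'[OF elem_interp_poly_ex1[OF assms, of k g]]
  unfolding elem_interp_poly_def[symmetric] by blast+

lemma lagrange_interp_on_elem:
  assumes "h > 0" "p \<ge> 1" "x \<in> mesh_elem h k"
  shows "lagrange_interp h p g x = poly (elem_interp_poly h p g k) x"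
proof (cases "x = of_int (k + 1) * h")
  case True
  have k1: "\<lfloor>x / h\<rfloor> = k + 1" using True assms by simp
  have x0: "grid_pt h p ((k + 1) * int p + int 0) = x"
    and x1: "grid_pt h p (k * int p + int p) = x"
    using assms True by (simp_all add: grid_pt_def field_simps)
  have "poly (elem_interp_poly h p g (k + 1)) x = g x"
    using elem_interp_poly(2)[OF assms(1,2), of 0 g "k + 1"] unfolding x0 by simp
  moreover have "poly (elem_interp_poly h p g k) x = g x"
    using elem_interp_poly(2)[OF assms(1,2), of p g k] unfolding x1 by simp
  ultimately show ?thesis by (simp add: lagrange_interp_def k1)
next
  case False
  then have "of_int k \<le> x / h" "x / h < of_int k + 1"
    using assms by (auto simp: mesh_elem_def field_simps)
  then have "\<lfloor>x / h\<rfloor> = k" by (simp add: floor_eq_iff)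
  then show ?thesis by (simp add: lagrange_interp_def)
qed

end

theory Submission
  imports Defs
begin

text \<open>
  Fix a grid point \<open>x\<close> and write \<open>U\<close> for the extension of \<open>u\<close> by zero, \<open>v\<close> for its interpolant
  and \<open>s = y - x\<close>. Two facts give the strain of \<open>v\<close> at \<open>x\<close> up to a small error.

  The first is that the interpolation error \<open>e = v - U\<close> satisfies \<open>\<bar>e y\<bar> \<le> K h\<^sup>p \<bar>y - x\<bar>\<close> for all \<open>y\<close>
  (\<open>lagrange_interp_error_at_grid_pt\<close>). The familiar bound \<open>\<bar>e\<bar> = O(h\<^sup>p\<^sup>+\<^sup>1)\<close> would not do, because it
  has to be divided by \<open>\<bar>s\<bar>\<close> and integrated over a neighbourhood of \<open>s = 0\<close>. The stronger bound holds
  because \<open>e\<close> vanishes at \<open>x\<close> and because \<open>p\<close> applications of Rolle's theorem bound \<open>e'\<close> by \<open>K h\<^sup>p\<close> on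
  every element. Since \<open>a\<close> and \<open>b\<close> are nodes, each element lies either in \<open>[a,b]\<close>, where \<open>U = u\<close> has
  \<open>p + 1\<close> derivatives, or where \<open>U = 0\<close>.

  The second is Taylor's formula for \<open>U\<close> on the whole line. The highest derivative supplied by the
  hypothesis on the extension (\<open>U''\<close>, or \<open>U'''\<close> for the last claim) is Lipschitz, because on \<open>[a,b]\<close>
  its derivative is bounded and outside it vanishes (\<open>zero_ext_deriv_lipschitz\<close>). Together,
  with \<open>\<sigma> = s / \<bar>s\<bar>\<close>,
  \<open>S(x + s, x; v) = \<sigma> U'(x) + \<bar>s\<bar> U''(x) / 2 (+ s\<^sup>3 / (6 \<bar>s\<bar>) U'''(x)) + O(\<bar>s\<bar>\<^sup>n) + O(h\<^sup>p)\<close>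
  with \<open>n = 2\<close> (or \<open>n = 3\<close>).

  The force averages the strain against \<open>2 / \<epsilon>\<^sup>2\<close> times an even weight. The odd terms drop out, the term
  in \<open>\<bar>s\<bar>\<close> reproduces the elastic modulus exactly, and a pointwise error of size \<open>B\<close> contributes at
  most \<open>4 M B / \<epsilon>\<close> (\<open>kernel_average_error\<close>). With \<open>B = O(\<epsilon>\<^sup>n + h\<^sup>p)\<close> this is
  \<open>O(\<epsilon>\<^sup>n\<^sup>-\<^sup>1 + h\<^sup>p / \<epsilon>)\<close>.

  For the nonlinear force, \<open>f'(\<bar>s\<bar> S\<^sup>2) S = f'(0) S + f''(0) \<bar>s\<bar> S\<^sup>3 + O(s\<^sup>2)\<close>, since the strain is bounded
  at a grid point uniformly in the mesh. The middle term is only of first order in \<open>s\<close> and would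
  leave an error \<open>O(1)\<close>, but its leading part \<open>f''(0) U'(x)\<^sup>3 s\<close> is odd and cancels as well
  (\<open>bond_force_expansion\<close>).
\<close>

section \<open>Error of Lagrange interpolation relative to a grid point\<close>

text \<open>Rolle's theorem between consecutive zeros. The zeros are kept in increasing order, so that the
  lemma can be iterated.\<close>

lemma consecutive_zeros_of_derivative:
  fixes f f' :: "real \<Rightarrow> real" and X :: "nat \<Rightarrow> real"
  assumes der: "\<And>x. x \<in> {\<alpha>..\<beta>} \<Longrightarrow> (f has_real_derivative f' x) (at x within {\<alpha>..\<beta>})"
    and mono: "\<And>i. i \<le> n \<Longrightarrow> X i < X (Suc i)"
    and zeros: "\<And>i. i \<le> Suc n \<Longrightarrow> X i \<in> {\<alpha>..\<beta>} \<and> f (X i) = 0"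
  obtains Y where "\<And>i. i < n \<Longrightarrow> Y i < Y (Suc i)"
    and "\<And>i. i \<le> n \<Longrightarrow> Y i \<in> {\<alpha>..\<beta>} \<and> f' (Y i) = 0"
proof -
  have "\<exists>y. X i < y \<and> y < X (Suc i) \<and> f' y = 0" if "i \<le> n" for i
  proof -
    have X: "X i < X (Suc i)" "X i \<in> {\<alpha>..\<beta>}" "X (Suc i) \<in> {\<alpha>..\<beta>}"
      using mono[of i] zeros[of i] zeros[of "Suc i"] that by auto
    have "\<exists>x\<in>{X i<..<X (Suc i)}. f (X (Suc i)) - f (X i) = f' x * (X (Suc i) - X i)"
    proof (rule mvt_simple[OF X(1), where f' = "\<lambda>x. (*) (f' x)"])
      fix x assume x: "X i \<le> x" "x \<le> X (Suc i)"
      have "(f has_real_derivative f' x) (at x within {X i..X (Suc i)})"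
        by (rule DERIV_subset[OF der]) (use x X in auto)
      then show "(f has_derivative (*) (f' x)) (at x within {X i..X (Suc i)})"
        unfolding has_field_derivative_def .
    qed
    then show ?thesis using zeros[of i] zeros[of "Suc i"] X(1) that by auto
  qed
  then obtain Y where Y: "\<And>i. i \<le> n \<Longrightarrow> X i < Y i \<and> Y i < X (Suc i) \<and> f' (Y i) = 0"
    by metis
  show ?thesis
  proof
    fix i assume "i < n"
    then show "Y i < Y (Suc i)" using Y[of i] Y[of "Suc i"] by linarith
  next
    fix i assume "i \<le> n"
    then show "Y i \<in> {\<alpha>..\<beta>} \<and> f' (Y i) = 0" using Y[of i] zeros[of i] zeros[of "Suc i"] by auto
  qed
qed

text \<open>The base of the estimates for Lagrange interpolation: a function with \<open>n + 1\<close> zeros has,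
  by Rolle, derivatives of all orders up to \<open>n\<close> that vanish somewhere, and each integration
  starting from a zero contributes a factor \<open>\<beta> - \<alpha>\<close>.\<close>

lemma bound_from_zeros:
  fixes d :: "nat \<Rightarrow> real \<Rightarrow> real" and X :: "nat \<Rightarrow> real"
  assumes "\<And>j x. j \<le> n \<Longrightarrow> x \<in> {\<alpha>..\<beta>} \<Longrightarrow>
      (d j has_real_derivative d (Suc j) x) (at x within {\<alpha>..\<beta>})"
    and "\<And>i. i < n \<Longrightarrow> X i < X (Suc i)"
    and "\<And>i. i \<le> n \<Longrightarrow> X i \<in> {\<alpha>..\<beta>} \<and> d 0 (X i) = 0"
    and "\<And>x. x \<in> {\<alpha>..\<beta>} \<Longrightarrow> \<bar>d (Suc n) x\<bar> \<le> K"
    and "x \<in> {\<alpha>..\<beta>}"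
  shows "\<bar>d 0 x\<bar> \<le> K * (\<beta> - \<alpha>) ^ Suc n"
  using assms
proof (induction n arbitrary: d X x)
  case 0
  have "norm (d 0 x - d 0 (X 0)) \<le> K * norm (x - X 0)"
    by (rule field_differentiable_bound[of "{\<alpha>..\<beta>}" "d 0" "d 1"]) (use 0 in auto)
  moreover have "K * norm (x - X 0) \<le> K * (\<beta> - \<alpha>)"
    using 0(3)[of 0] 0(4)[OF 0(5)] 0(5) by (intro mult_left_mono) auto
  ultimately show ?case using 0(3)[of 0] by simp
next
  case (Suc n)
  obtain Y where Y: "\<And>i. i < n \<Longrightarrow> Y i < Y (Suc i)"
      "\<And>i. i \<le> n \<Longrightarrow> Y i \<in> {\<alpha>..\<beta>} \<and> d 1 (Y i) = 0"
    by (rule consecutive_zeros_of_derivative[of \<alpha> \<beta> "d 0" "d 1" n X]) (use Suc.prems in auto)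
  have d1: "\<bar>d 1 z\<bar> \<le> K * (\<beta> - \<alpha>) ^ Suc n" if "z \<in> {\<alpha>..\<beta>}" for z
    using Suc.IH[of "\<lambda>j. d (Suc j)" Y z] Suc.prems Y that by simp
  have "norm (d 0 x - d 0 (X 0)) \<le> (K * (\<beta> - \<alpha>) ^ Suc n) * norm (x - X 0)"
    by (rule field_differentiable_bound[of "{\<alpha>..\<beta>}" "d 0" "d 1"]) (use Suc.prems d1 in auto)
  moreover have "(K * (\<beta> - \<alpha>) ^ Suc n) * norm (x - X 0) \<le> (K * (\<beta> - \<alpha>) ^ Suc n) * (\<beta> - \<alpha>)"
    using Suc.prems(3)[of 0] d1[OF Suc.prems(5)] Suc.prems(5) by (intro mult_left_mono) auto
  ultimately show ?case using Suc.prems(3)[of 0] by (simp add: mult_ac)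
qed

text \<open>The same for the first derivative, which has one zero less. This is the rate at which the
  function can grow away from a zero.\<close>

lemma derivative_bound_from_zeros:
  fixes d :: "nat \<Rightarrow> real \<Rightarrow> real" and X :: "nat \<Rightarrow> real"
  assumes der: "\<And>j x. j \<le> n \<Longrightarrow> x \<in> {\<alpha>..\<beta>} \<Longrightarrow>
      (d j has_real_derivative d (Suc j) x) (at x within {\<alpha>..\<beta>})"
    and "n \<ge> 1"
    and mono: "\<And>i. i < n \<Longrightarrow> X i < X (Suc i)"
    and zeros: "\<And>i. i \<le> n \<Longrightarrow> X i \<in> {\<alpha>..\<beta>} \<and> d 0 (X i) = 0"
    and bound: "\<And>x. x \<in> {\<alpha>..\<beta>} \<Longrightarrow> \<bar>d (Suc n) x\<bar> \<le> K"
    and "x \<in> {\<alpha>..\<beta>}"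
  shows "\<bar>d 1 x\<bar> \<le> K * (\<beta> - \<alpha>) ^ n"
proof -
  obtain m where n: "n = Suc m" using \<open>n \<ge> 1\<close> by (cases n) auto
  obtain Y where "\<And>i. i < m \<Longrightarrow> Y i < Y (Suc i)"
      "\<And>i. i \<le> m \<Longrightarrow> Y i \<in> {\<alpha>..\<beta>} \<and> d 1 (Y i) = 0"
    by (rule consecutive_zeros_of_derivative[of \<alpha> \<beta> "d 0" "d 1" m X]) (use der mono zeros n in auto)
  then show ?thesis
    using bound_from_zeros[of m \<alpha> \<beta> "\<lambda>j. d (Suc j)" Y K x] der bound \<open>x \<in> {\<alpha>..\<beta>}\<close> n by simp
qed

text \<open>The derivatives are witnessed by some sequence \<open>d\<close>, so that the same predicate covers elements
  inside \<open>[a,b]\<close>, where \<open>d\<close> consists of one-sided derivatives relative to \<open>[a,b]\<close>, and elements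
  outside, where \<open>d = 0\<close>.\<close>

definition bounded_deriv_chain :: "real set \<Rightarrow> nat \<Rightarrow> real \<Rightarrow> (real \<Rightarrow> real) \<Rightarrow> bool" where
  "bounded_deriv_chain S n K g \<longleftrightarrow> (\<exists>d. (\<forall>y\<in>S. d 0 y = g y) \<and>
     (\<forall>j<n. \<forall>y\<in>S. (d j has_real_derivative d (Suc j) y) (at y within S)) \<and>
     (\<forall>y\<in>S. \<bar>d n y\<bar> \<le> K))"

lemma higher_pderiv_eq_0: "degree q < n \<Longrightarrow> (pderiv ^^ n) q = (0::real poly)"
  by (intro poly_eqI) (simp add: coeff_higher_pderiv coeff_eq_0)

text \<open>The error has the \<open>p + 1\<close> grid points of the element as zeros, and its derivative of order \<open>p + 1\<close>
  is that of \<open>g\<close> up to sign, because the interpolating polynomial has degree at most \<open>p\<close>.\<close>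

lemma elem_interp_error_lipschitz:
  assumes "h > 0" "p \<ge> 1" "bounded_deriv_chain (mesh_elem h k) (Suc p) K g"
    and y: "y \<in> mesh_elem h k" and z: "z \<in> mesh_elem h k"
  defines "e \<equiv> \<lambda>t. poly (elem_interp_poly h p g k) t - g t"
  shows "\<bar>e y - e z\<bar> \<le> K * h ^ p * \<bar>y - z\<bar>"
proof -
  let ?q = "elem_interp_poly h p g k"
  define \<alpha> \<beta> where "\<alpha> = of_int k * h" and "\<beta> = of_int (k + 1) * h"
  have E: "mesh_elem h k = {\<alpha>..\<beta>}" and len: "\<beta> - \<alpha> = h"
    by (auto simp: mesh_elem_def \<alpha>_def \<beta>_def algebra_simps)
  obtain d where d0: "\<And>t. t \<in> {\<alpha>..\<beta>} \<Longrightarrow> d 0 t = g t"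
    and dd: "\<And>j t. j \<le> p \<Longrightarrow> t \<in> {\<alpha>..\<beta>} \<Longrightarrow>
               (d j has_real_derivative d (Suc j) t) (at t within {\<alpha>..\<beta>})"
    and dK: "\<And>t. t \<in> {\<alpha>..\<beta>} \<Longrightarrow> \<bar>d (Suc p) t\<bar> \<le> K"
    using assms(3) unfolding bounded_deriv_chain_def E less_Suc_eq_le by blast
  define D where "D j t = poly ((pderiv ^^ j) ?q) t - d j t" for j t
  have D0: "D 0 t = e t" if "t \<in> {\<alpha>..\<beta>}" for t
    using d0[OF that] by (simp add: D_def e_def)
  have DD: "(D j has_real_derivative D (Suc j) t) (at t within {\<alpha>..\<beta>})"
    if "j \<le> p" "t \<in> {\<alpha>..\<beta>}" for j t
    unfolding D_def using dd[OF that]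
    by (auto intro!: derivative_eq_intros has_field_derivative_at_within[OF poly_DERIV])
  have DK: "\<bar>D (Suc p) t\<bar> \<le> K" if "t \<in> {\<alpha>..\<beta>}" for t
    using dK[OF that] higher_pderiv_eq_0[of ?q "Suc p"] elem_interp_poly(1)[OF assms(1,2), of g k]
    by (simp add: D_def)
  define X where "X j = grid_pt h p (k * int p + int j)" for j
  have X_eq: "X j = \<alpha> + h * (j / p)" for j
    using \<open>p \<ge> 1\<close> by (simp add: X_def grid_pt_def \<alpha>_def field_simps)
  have X_in: "X j \<in> {\<alpha>..\<beta>}" if "j \<le> p" for j
  proof -
    have "h * (j / p) \<le> h * 1"
      using \<open>h > 0\<close> that by (intro mult_left_mono) (auto simp: divide_le_eq)
    then show ?thesis using len \<open>h > 0\<close> by (simp add: X_eq)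
  qed
  have X_mono: "X j < X (Suc j)" for j
    using \<open>h > 0\<close> \<open>p \<ge> 1\<close> by (simp add: X_eq divide_strict_right_mono)
  have X_zero: "D 0 (X j) = 0" if "j \<le> p" for j
    using elem_interp_poly(2)[OF assms(1,2) that, of g k] D0[OF X_in[OF that]]
    by (simp add: X_def e_def)
  have D1: "\<bar>D 1 t\<bar> \<le> K * h ^ p" if "t \<in> {\<alpha>..\<beta>}" for t
    using derivative_bound_from_zeros[of p \<alpha> \<beta> D X K t] DD DK X_in X_mono X_zero \<open>p \<ge> 1\<close> that
    unfolding len by blast
  have "norm (D 0 y - D 0 z) \<le> K * h ^ p * norm (y - z)"
    by (rule field_differentiable_bound[of "{\<alpha>..\<beta>}" "D 0" "D 1"])
       (use DD[of 0] D1 y z E in auto)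
  then show ?thesis using D0 y z E by simp
qed

lemma grid_pt_in_elem:
  assumes "h > 0" "p \<ge> 1"
  obtains k j where "j \<le> p" "i = k * int p + int j" "grid_pt h p i \<in> mesh_elem h k"
proof
  let ?k = "i div int p" and ?j = "nat (i mod int p)"
  have j: "0 \<le> i mod int p" "i mod int p < int p" using \<open>p \<ge> 1\<close> by auto
  show "?j \<le> p" using j by linarith
  show i: "i = ?k * int p + int ?j" using j by simp
  have "real_of_int i = real_of_int ?k * real p + real ?j"
    using arg_cong[OF i, of real_of_int] unfolding of_int_add of_int_mult of_int_of_nat_eq .
  then have g: "grid_pt h p i = of_int ?k * h + h * (?j / p)"
    using \<open>p \<ge> 1\<close> by (simp add: grid_pt_def field_simps)
  have "h * (?j / p) \<le> h * 1"
    using \<open>h > 0\<close> \<open>?j \<le> p\<close> by (intro mult_left_mono) (auto simp: divide_le_eq)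
  then show "grid_pt h p i \<in> mesh_elem h ?k"
    using \<open>h > 0\<close> by (simp add: mesh_elem_def g algebra_simps)
qed

lemma lagrange_interp_at_grid_pt:
  assumes "h > 0" "p \<ge> 1"
  shows "lagrange_interp h p g (grid_pt h p i) = g (grid_pt h p i)"
proof -
  obtain k j where kj: "j \<le> p" "i = k * int p + int j" "grid_pt h p i \<in> mesh_elem h k"
    using grid_pt_in_elem[OF assms] by blast
  then show ?thesis
    using lagrange_interp_on_elem[OF assms kj(3)] elem_interp_poly(2)[OF assms kj(1), of g k]
    by (simp add: kj(2))
qed

text \<open>The previous bound compares points of one element. If \<open>y\<close> lies in a different element
  than the grid point, the boundary point of the element of \<open>y\<close> on the side of the grid point takes
  its place: the error vanishes there too, and it is closer to \<open>y\<close>.\<close>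

lemma lagrange_interp_error_at_grid_pt:
  assumes "h > 0" "p \<ge> 1" "K \<ge> 0"
    and chain: "\<And>k. bounded_deriv_chain (mesh_elem h k) (Suc p) K g"
  shows "\<bar>lagrange_interp h p g y - g y\<bar> \<le> K * h ^ p * \<bar>y - grid_pt h p i\<bar>"
proof -
  define x where "x = grid_pt h p i"
  define k where "k = \<lfloor>y / h\<rfloor>"
  have y: "y \<in> mesh_elem h k"
    using floor_divide_lower[of h y] floor_divide_upper[of h y] \<open>h > 0\<close>
    unfolding mesh_elem_def k_def atLeastAtMost_iff of_int_add of_int_1 by (blast intro: less_imp_le)
  \<comment> \<open>the point of the element of \<open>y\<close> closest to \<open>x\<close>; it is \<open>x\<close> itself or an end point of the element\<close>
  define z where "z = max (of_int k * h) (min (of_int (k + 1) * h) x)"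
  have z: "z \<in> mesh_elem h k"
    using \<open>h > 0\<close> by (auto simp: mesh_elem_def z_def algebra_simps)
  have "\<exists>i'. z = grid_pt h p i'"
  proof -
    have "of_int l * h = grid_pt h p (l * int p)" for l
      using \<open>p \<ge> 1\<close> by (simp add: grid_pt_def)
    then show ?thesis unfolding z_def x_def by (metis max_def min_def)
  qed
  then have "poly (elem_interp_poly h p g k) z - g z = 0"
    using lagrange_interp_at_grid_pt[OF assms(1,2), of g] lagrange_interp_on_elem[OF assms(1,2) z, of g]
    by auto
  then have "\<bar>lagrange_interp h p g y - g y\<bar> \<le> K * h ^ p * \<bar>y - z\<bar>"
    using elem_interp_error_lipschitz[OF assms(1,2) chain y z]
      lagrange_interp_on_elem[OF assms(1,2) y, of g] by simp
  also have "\<dots> \<le> K * h ^ p * \<bar>y - x\<bar>"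
    using y assms(1,3) by (intro mult_left_mono) (auto simp: z_def mesh_elem_def)
  finally show ?thesis unfolding x_def .
qed

text \<open>The interpolant is a countable case distinction between polynomials.\<close>

lemma lagrange_interp_borel_measurable: "lagrange_interp h p g \<in> borel_measurable borel"
proof -
  have fl: "(\<lambda>x::real. \<lfloor>x / h\<rfloor>) \<in> borel \<rightarrow>\<^sub>M count_space UNIV" by measurable
  have "(\<lambda>x. poly (elem_interp_poly h p g \<lfloor>x / h\<rfloor>) x) \<in> borel_measurable borel"
    by (rule measurable_compose_countable[OF _ fl])
       (intro borel_measurable_continuous_onI continuous_intros)
  then show ?thesis unfolding lagrange_interp_def[abs_def] .
qed

section \<open>Regularity of the extension by zero\<close>

lemma nth_deriv_on_0 [simp]: "nth_deriv_on S 0 u = u"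
  by (simp add: nth_deriv_on_def)

lemma C_on_deriv:
  assumes "C_on S n u" "k < n" "x \<in> S"
  shows "(nth_deriv_on S k u has_real_derivative nth_deriv_on S (Suc k) u x) (at x within S)"
  using assms by (auto simp: C_on_def)

lemma C_on_continuous_on:
  assumes "C_on S n u" "k \<le> n"
  shows "continuous_on S (nth_deriv_on S k u)"
proof (cases "k = n")
  case False
  then have "k < n" using assms(2) by simp
  then show ?thesis
    using assms(1) by (intro DERIV_continuous_on[of S _ "nth_deriv_on S (Suc k) u"]) (auto intro: C_on_deriv)
qed (use assms(1) in \<open>simp add: C_on_def\<close>)

lemma C_on_mono: "C_on S n u \<Longrightarrow> m \<le> n \<Longrightarrow> C_on S m u"
  using C_on_continuous_on[of S n u m] by (auto simp: C_on_def)

text \<open>On the open exterior all derivatives of the extension vanish because the extension does; at \<open>a\<close> and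
  \<open>b\<close> they vanish by continuity.\<close>

lemma zero_ext_deriv_outside:
  assumes "C_on UNIV n (zero_ext a b u)" "j \<le> n" "x \<le> a \<or> x \<ge> b"
  shows "nth_deriv_on UNIV j (zero_ext a b u) x = 0"
proof -
  let ?d = "\<lambda>j. nth_deriv_on UNIV j (zero_ext a b u)"
  have "\<forall>y\<in>{..<a} \<union> {b<..}. ?d j y = 0" using \<open>j \<le> n\<close>
  proof (induction j)
    case 0
    then show ?case by (auto simp: zero_ext_def)
  next
    case (Suc j)
    show ?case
    proof
      fix y assume y: "y \<in> {..<a} \<union> {b<..}"
      have "(?d j has_real_derivative ?d (Suc j) y) (at y)"
        using C_on_deriv[OF assms(1), of j y] Suc.prems by simp
      moreover have "(?d j has_real_derivative 0) (at y)"
        by (rule has_field_derivative_transform_within_open[of "\<lambda>_. 0" 0 y "{..<a} \<union> {b<..}"])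
           (use Suc y in auto)
      ultimately show "?d (Suc j) y = 0" by (rule DERIV_unique)
    qed
  qed
  moreover have "closed {y. ?d j y = 0}"
    using C_on_continuous_on[OF assms(1,2)] closed_Collect_eq[of "?d j" "\<lambda>_. 0"] by simp
  ultimately have "closure ({..<a} \<union> {b<..}) \<subseteq> {y. ?d j y = 0}"
    by (intro closure_minimal) auto
  then show ?thesis using assms(3) by (auto simp: closure_Un)
qed

lemma zero_ext_deriv_inside:
  assumes "a < b" "C_on {a..b} n u" "C_on UNIV n (zero_ext a b u)" "j \<le> n" "x \<in> {a..b}"
  shows "nth_deriv_on UNIV j (zero_ext a b u) x = nth_deriv_on {a..b} j u x"
  using assms(4,5)
proof (induction j arbitrary: x)
  case 0
  then show ?case by (simp add: zero_ext_def)
next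
  case (Suc j)
  have "(nth_deriv_on UNIV j (zero_ext a b u) has_real_derivative
      nth_deriv_on UNIV (Suc j) (zero_ext a b u) x) (at x within {a..b})"
    using C_on_deriv[OF assms(3), of j x] Suc.prems has_field_derivative_at_within by auto
  then have "(nth_deriv_on {a..b} j u has_real_derivative
      nth_deriv_on UNIV (Suc j) (zero_ext a b u) x) (at x within {a..b})"
    by (rule has_field_derivative_transform_within[OF _ zero_less_one Suc.prems(2)])
       (use Suc in auto)
  then show ?case
    using C_on_deriv[OF assms(2), of j x] Suc.prems \<open>a < b\<close>
      vector_derivative_unique_within_closed_interval[of a b x]
    by (auto simp: has_real_derivative_iff_has_vector_derivative)
qed

text \<open>The extension has \<open>n\<close> derivatives across \<open>a\<close> and \<open>b\<close>, while the next one is available in \<open>[a,b]\<close>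
  only. The \<open>n\<close>-th derivative is nevertheless Lipschitz on the line: its value at a point equals its
  value at the nearest point of \<open>[a,b]\<close>, and projection to an interval does not increase distances.\<close>

lemma zero_ext_deriv_lipschitz:
  assumes "a < b" "C_on {a..b} (Suc n) u" "C_on UNIV n (zero_ext a b u)"
    and bound: "\<And>x. x \<in> {a..b} \<Longrightarrow> \<bar>nth_deriv_on {a..b} (Suc n) u x\<bar> \<le> L"
  shows "\<bar>nth_deriv_on UNIV n (zero_ext a b u) y - nth_deriv_on UNIV n (zero_ext a b u) z\<bar> \<le> L * \<bar>y - z\<bar>"
proof -
  let ?d = "nth_deriv_on UNIV n (zero_ext a b u)"
  define c where "c t = max a (min b t)" for t
  have c: "c t \<in> {a..b}" for t using \<open>a < b\<close> by (auto simp: c_def)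
  have clamp: "?d t = nth_deriv_on {a..b} n u (c t)" for t
  proof -
    have "?d t = ?d (c t)"
    proof (cases "t \<in> {a..b}")
      case False
      then have "t < a \<and> c t = a \<or> t > b \<and> c t = b" using \<open>a < b\<close> by (auto simp: c_def)
      then show ?thesis
        using zero_ext_deriv_outside[OF assms(3), of n t] zero_ext_deriv_outside[OF assms(3), of n "c t"]
        by auto
    qed (simp add: c_def)
    also have "\<dots> = nth_deriv_on {a..b} n u (c t)"
      by (rule zero_ext_deriv_inside[OF assms(1) C_on_mono[OF assms(2)] assms(3) _ c]) auto
    finally show ?thesis .
  qed
  have "norm (nth_deriv_on {a..b} n u (c y) - nth_deriv_on {a..b} n u (c z)) \<le> L * norm (c y - c z)"
    by (rule field_differentiable_bound[of "{a..b}" _ "nth_deriv_on {a..b} (Suc n) u"])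
       (use C_on_deriv[OF assms(2)] bound c in auto)
  also have "\<dots> \<le> L * \<bar>y - z\<bar>"
  proof (rule mult_left_mono)
    show "norm (c y - c z) \<le> \<bar>y - z\<bar>" unfolding c_def max_def min_def by auto
    show "0 \<le> L" using bound[OF c[of y]] by linarith
  qed
  finally show ?thesis unfolding clamp by simp
qed

lemma mesh_endpoints:
  assumes "a < b" "h > 0" "union_of_elems h (closure {a..b})"
  obtains A B :: int where "a = of_int A * h" "b = of_int B * h" "A < B"
proof -
  obtain ks where ks: "{a..b} = (\<Union>k\<in>ks. mesh_elem h k)"
    using assms(3) by (auto simp: union_of_elems_def)
  have "a \<in> {a..b}" "b \<in> {a..b}" using \<open>a < b\<close> by auto
  then obtain k l where kl: "k \<in> ks" "a \<in> mesh_elem h k" "l \<in> ks" "b \<in> mesh_elem h l"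
    unfolding ks by blast
  have ends: "of_int i * h \<in> mesh_elem h i" "of_int (i + 1) * h \<in> mesh_elem h i" for i
    using \<open>h > 0\<close> by (auto simp: mesh_elem_def algebra_simps)
  \<comment> \<open>the elements that contain \<open>a\<close> and \<open>b\<close> are themselves contained in \<open>[a,b]\<close>\<close>
  have "of_int k * h \<in> {a..b}" "of_int (l + 1) * h \<in> {a..b}"
    using kl(1,3) ends unfolding ks by blast+
  then have "a = of_int k * h" "b = of_int (l + 1) * h"
    using kl(2,4) by (auto simp: mesh_elem_def)
  moreover from this have "k < l + 1"
    using \<open>a < b\<close> \<open>h > 0\<close> mult_less_cancel_right_pos[of h "of_int k" "of_int (l + 1)"] by auto
  ultimately show ?thesis using that by blast
qed

lemma bounded_deriv_chain_zero_ext: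
  assumes "a < b" "h > 0" "union_of_elems h (closure {a..b})"
    and reg: "C_on {a..b} n u" and ext: "C_on UNIV 0 (zero_ext a b u)"
    and bound: "\<And>x. x \<in> {a..b} \<Longrightarrow> \<bar>nth_deriv_on {a..b} n u x\<bar> \<le> K"
  shows "bounded_deriv_chain (mesh_elem h k) n K (zero_ext a b u)"
proof -
  obtain A B :: int where AB: "a = of_int A * h" "b = of_int B * h"
    using mesh_endpoints[OF assms(1-3)] by blast
  have le: "of_int i * h \<le> of_int j * h" if "i \<le> j" for i j
    using that \<open>h > 0\<close> by simp
  consider "A \<le> k" "k + 1 \<le> B" | "k + 1 \<le> A" | "B \<le> k" by linarith
  then show ?thesis
  proof cases
    case 1
    have sub: "mesh_elem h k \<subseteq> {a..b}"
      using le[OF 1(1)] le[OF 1(2)] unfolding mesh_elem_def AB by (intro atLeastatMost_subset_iff[THEN iffD2]) auto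
    show ?thesis
      unfolding bounded_deriv_chain_def
    proof (intro exI[of _ "\<lambda>j. nth_deriv_on {a..b} j u"] conjI ballI allI impI)
      fix j y assume "j < n" "y \<in> mesh_elem h k"
      then show "(nth_deriv_on {a..b} j u has_real_derivative nth_deriv_on {a..b} (Suc j) u y)
          (at y within mesh_elem h k)"
        using DERIV_subset[OF C_on_deriv[OF reg, of j y] sub] sub by auto
    qed (use sub bound in \<open>auto simp: zero_ext_def\<close>)
  next
    case 2
    have "mesh_elem h k \<subseteq> {..a}" using le[OF 2] unfolding mesh_elem_def AB by auto
    then show ?thesis
      unfolding bounded_deriv_chain_def using zero_ext_deriv_outside[OF ext, of 0] bound[of a] \<open>a < b\<close>
      by (intro exI[of _ "\<lambda>_ _. 0"]) auto
  next
    case 3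
    have "mesh_elem h k \<subseteq> {b..}" using le[OF 3] unfolding mesh_elem_def AB by auto
    then show ?thesis
      unfolding bounded_deriv_chain_def using zero_ext_deriv_outside[OF ext, of 0] bound[of a] \<open>a < b\<close>
      by (intro exI[of _ "\<lambda>_ _. 0"]) auto
  qed
qed

section \<open>Taylor expansion of the strain\<close>

text \<open>In the Lagrange form of the remainder the highest derivative is taken at an intermediate point;
  a Lipschitz condition moves it to \<open>x\<close>. This form suits the extension by zero, whose next derivative
  may jump at \<open>a\<close> and \<open>b\<close>.\<close>

lemma taylor_lipschitz:
  fixes d :: "nat \<Rightarrow> real \<Rightarrow> real"
  assumes der: "\<And>j t. j < n \<Longrightarrow> (d j has_real_derivative d (Suc j) t) (at t)"
    and lip: "\<And>y z. \<bar>d n y - d n z\<bar> \<le> L * \<bar>y - z\<bar>"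
  shows "\<bar>d 0 y - (\<Sum>j\<le>n. d j x / fact j * (y - x) ^ j)\<bar> \<le> L * \<bar>y - x\<bar> ^ Suc n"
proof (cases "n = 0 \<or> y = x")
  case True
  then show ?thesis
  proof
    assume "n = 0"
    then show ?thesis using lip[of y x] by simp
  next
    assume "y = x"
    moreover have "(\<Sum>j\<le>n. d j x / fact j * (x - x) ^ j) = (\<Sum>j\<le>n. if j = 0 then d 0 x else 0)"
      by (intro sum.cong) auto
    ultimately show ?thesis by simp
  qed
next
  case False
  then obtain t where t: "if y < x then y < t \<and> t < x else x < t \<and> t < y"
    and exp: "d 0 y = (\<Sum>j<n. d j x / fact j * (y - x) ^ j) + d n t / fact n * (y - x) ^ n"
    using Taylor[of n d "d 0" "min x y" "max x y" x y] der by auto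
  have "L * 1 \<ge> 0" using lip[of 1 0] by auto
  then have "\<bar>d n t - d n x\<bar> \<le> L * \<bar>y - x\<bar>"
    using t by (intro order_trans[OF lip] mult_left_mono) (auto split: if_splits)
  moreover have "(1::real) / fact n \<le> 1" by simp
  ultimately have "\<bar>d n t - d n x\<bar> * (1 / fact n) \<le> L * \<bar>y - x\<bar> * 1"
    using \<open>L * 1 \<ge> 0\<close> by (intro mult_mono) auto
  then have "\<bar>d n t - d n x\<bar> * (1 / fact n) * \<bar>y - x\<bar> ^ n \<le> L * \<bar>y - x\<bar> * 1 * \<bar>y - x\<bar> ^ n"
    by (rule mult_right_mono) auto
  moreover have "d 0 y - (\<Sum>j\<le>n. d j x / fact j * (y - x) ^ j)
      = (d n t - d n x) * (1 / fact n) * (y - x) ^ n"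
    unfolding exp lessThan_Suc_atMost[symmetric] sum.lessThan_Suc by (simp add: field_simps)
  ultimately show ?thesis by (simp add: abs_mult power_abs mult_ac)
qed

text \<open>At \<open>y = x\<close> both sides of the expansion are zero thanks to \<open>0 / 0 = 0\<close>, hence the quotients
  \<open>(y - x) ^ j / \<bar>y - x\<bar>\<close> are left as they are.\<close>

lemma strain_expansion:
  fixes d :: "nat \<Rightarrow> real \<Rightarrow> real"
  assumes der: "\<And>j t. j < n \<Longrightarrow> (d j has_real_derivative d (Suc j) t) (at t)"
    and lip: "\<And>y z. \<bar>d n y - d n z\<bar> \<le> L * \<bar>y - z\<bar>"
    and v: "v x = d 0 x" "\<bar>v y - d 0 y\<bar> \<le> \<eta> * \<bar>y - x\<bar>" and "\<eta> \<ge> 0"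
  shows "\<bar>strain v y x - (\<Sum>j=1..n. d j x / fact j * ((y - x) ^ j / \<bar>y - x\<bar>))\<bar>
           \<le> L * \<bar>y - x\<bar> ^ n + \<eta>"
proof (cases "y = x")
  case True
  have "L \<ge> 0" using lip[of 1 0] by auto
  then show ?thesis using True \<open>\<eta> \<ge> 0\<close> by (simp add: strain_def)
next
  case False
  then have pos: "\<bar>y - x\<bar> > 0" by simp
  have "{..n} = insert 0 {1..n}" by auto
  then have "d 0 y - (\<Sum>j\<le>n. d j x / fact j * (y - x) ^ j)
      = d 0 y - d 0 x - (\<Sum>j=1..n. d j x / fact j * (y - x) ^ j)"
    by simp
  then have "\<bar>v y - v x - (\<Sum>j=1..n. d j x / fact j * (y - x) ^ j)\<bar>
      \<le> L * \<bar>y - x\<bar> ^ Suc n + \<eta> * \<bar>y - x\<bar>"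
    using taylor_lipschitz[of n d L y x, OF der lip] v by linarith
  also have "\<dots> = (L * \<bar>y - x\<bar> ^ n + \<eta>) * \<bar>y - x\<bar>" by (simp add: algebra_simps)
  finally have "\<bar>v y - v x - (\<Sum>j=1..n. d j x / fact j * (y - x) ^ j)\<bar> / \<bar>y - x\<bar>
      \<le> L * \<bar>y - x\<bar> ^ n + \<eta>"
    using pos by (simp add: pos_divide_le_eq)
  moreover have "strain v y x - (\<Sum>j=1..n. d j x / fact j * ((y - x) ^ j / \<bar>y - x\<bar>))
      = (v y - v x - (\<Sum>j=1..n. d j x / fact j * (y - x) ^ j)) / \<bar>y - x\<bar>"
    by (simp add: strain_def diff_divide_distrib sum_divide_distrib)
  ultimately show ?thesis by simp
qed

section \<open>Averaging against a symmetric influence function\<close>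

text \<open>Affine substitution for functions that are only Lebesgue measurable, such as the influence function.\<close>

lemma lebesgue_integral_real_affine:
  fixes f :: "real \<Rightarrow> real"
  assumes f[measurable]: "f \<in> borel_measurable lebesgue" and c: "c \<noteq> 0"
  shows "integral\<^sup>L lebesgue f = \<bar>c\<bar> * integral\<^sup>L lebesgue (\<lambda>x. f (t + c * x))"
proof -
  have T[measurable]: "(\<lambda>x::real. t + c * x) \<in> lebesgue \<rightarrow>\<^sub>M lebesgue"
    using lebesgue_affine_measurable[of "\<lambda>x::real. c" t] c by simp
  have "integral\<^sup>L lebesgue f
      = integral\<^sup>L (density (distr lebesgue lebesgue (\<lambda>x. t + c * x)) (\<lambda>_. ennreal \<bar>c\<bar>)) f"
    using lebesgue_real_affine[OF c, of t] by simp
  also have "\<dots> = integral\<^sup>L (distr lebesgue lebesgue (\<lambda>x. t + c * x)) (\<lambda>x. \<bar>c\<bar> *\<^sub>R f x)"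
    by (rule integral_density) auto
  also have "\<dots> = \<bar>c\<bar> * integral\<^sup>L lebesgue (\<lambda>x. f (t + c * x))"
    by (subst integral_distr) auto
  finally show ?thesis .
qed

text \<open>The scaling \<open>y = x + \<epsilon> z\<close> turns the average into an integral over \<open>[-1,1]\<close> with the even weight
  \<open>w z = J \<bar>z\<bar>\<close>. The odd part \<open>P\<close> of the integrand integrates to zero, \<open>c / 2 * \<bar>s\<bar>\<close> gives the moment of
  \<open>J\<close>, and what remains is at most \<open>B\<close> on an interval of length \<open>2\<close>.\<close>

lemma kernel_average_error:
  fixes J G P :: "real \<Rightarrow> real"
  assumes J_meas: "(\<lambda>\<xi>. J \<bar>\<xi>\<bar>) \<in> borel_measurable lebesgue"
    and J_bounds: "\<And>\<xi>. \<xi> \<in> {-1..1} \<Longrightarrow> 0 \<le> J \<bar>\<xi>\<bar> \<and> J \<bar>\<xi>\<bar> \<le> M"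
    and "\<epsilon> > 0"
    and G[measurable]: "G \<in> borel_measurable borel"
    and P[measurable]: "P \<in> borel_measurable borel"
    and odd: "\<And>s. P (- s) = - P s"
    and P_bound: "\<And>s. \<bar>s\<bar> \<le> \<epsilon> \<Longrightarrow> \<bar>P s\<bar> \<le> N"
    and approx: "\<And>s. \<bar>s\<bar> \<le> \<epsilon> \<Longrightarrow> \<bar>G (x + s) - P s - c / 2 * \<bar>s\<bar>\<bar> \<le> B"
  shows "\<bar>2 / \<epsilon>\<^sup>2 * (LINT y:{x - \<epsilon>..x + \<epsilon>}|lebesgue. J (\<bar>y - x\<bar> / \<epsilon>) * G y)
           - c * (LINT z:{-1..1}|lebesgue. J \<bar>z\<bar> * \<bar>z\<bar>)\<bar> \<le> 4 * M * B / \<epsilon>"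
proof -
  define w where "w z = indicator {-1..1} z * J \<bar>z\<bar>" for z :: real
  have w_meas[measurable]: "w \<in> borel_measurable lebesgue"
    unfolding w_def by (intro borel_measurable_times borel_measurable_indicator J_meas) auto
  have w_even: "w (- z) = w z" for z by (auto simp: w_def indicator_def)
  have w_bound: "0 \<le> w z" "w z \<le> M * indicator {-1..1} z" for z
    using J_bounds[of z] by (auto simp: w_def indicator_def)
  have scale: "\<bar>\<epsilon> * z\<bar> \<le> \<epsilon>" if "z \<in> {-1..1}" for z
    using that \<open>\<epsilon> > 0\<close> by (simp add: abs_mult mult_left_le abs_le_iff)
  have w_integrable: "integrable lebesgue (\<lambda>z. w z * g z)"
    if g: "g \<in> borel_measurable borel" and b: "\<And>z. z \<in> {-1..1} \<Longrightarrow> \<bar>g z\<bar> \<le> A"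
    for g :: "real \<Rightarrow> real" and A
  proof (rule integrableI_bounded_set[where A = "{-1..1}" and B = "M * A"])
    have "g \<in> borel_measurable lebesgue" using g by (intro measurable_completion) auto
    then show "(\<lambda>z. w z * g z) \<in> borel_measurable lebesgue" by measurable
    have "\<bar>w z * g z\<bar> \<le> M * A" if "z \<in> {-1..1}" for z
      using mult_mono[OF _ b[OF that], of "\<bar>w z\<bar>" M] w_bound[of z] that by (auto simp: abs_mult)
    then show "AE z in lebesgue. z \<in> {-1..1} \<longrightarrow> norm (w z * g z) \<le> M * A" by auto
    show "AE z in lebesgue. z \<notin> {-1..1} \<longrightarrow> w z * g z = 0" by (auto simp: w_def)
  qed auto
  have substitution: "(LINT y:{x - \<epsilon>..x + \<epsilon>}|lebesgue. J (\<bar>y - x\<bar> / \<epsilon>) * G y)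
      = \<epsilon> * (LINT z|lebesgue. w z * G (x + \<epsilon> * z))"
  proof -
    define F where "F y = w (- x / \<epsilon> + (1 / \<epsilon>) * y) * G y" for y
    have [measurable]: "(\<lambda>y::real. - x / \<epsilon> + (1 / \<epsilon>) * y) \<in> lebesgue \<rightarrow>\<^sub>M lebesgue"
      using lebesgue_affine_measurable[of "\<lambda>x::real. 1 / \<epsilon>" "- x / \<epsilon>"] \<open>\<epsilon> > 0\<close> by simp
    have [measurable]: "G \<in> borel_measurable lebesgue" using G by (intro measurable_completion) auto
    have F_meas: "F \<in> borel_measurable lebesgue" unfolding F_def by measurable
    have F_eq: "indicator {x - \<epsilon>..x + \<epsilon>} y * (J (\<bar>y - x\<bar> / \<epsilon>) * G y) = F y" for y
    proof -
      have arg: "- x / \<epsilon> + (1 / \<epsilon>) * y = (y - x) / \<epsilon>" by (simp add: diff_divide_distrib)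
      have "(y - x) / \<epsilon> \<in> {-1..1} \<longleftrightarrow> y \<in> {x - \<epsilon>..x + \<epsilon>}"
        using \<open>\<epsilon> > 0\<close> by (auto simp: field_simps)
      then show ?thesis
        using \<open>\<epsilon> > 0\<close> unfolding F_def w_def arg by (auto simp: indicator_def abs_divide)
    qed
    have "integral\<^sup>L lebesgue F = \<bar>\<epsilon>\<bar> * integral\<^sup>L lebesgue (\<lambda>z. F (x + \<epsilon> * z))"
      by (rule lebesgue_integral_real_affine[OF F_meas]) (use \<open>\<epsilon> > 0\<close> in auto)
    also have "(\<lambda>z. F (x + \<epsilon> * z)) = (\<lambda>z. w z * G (x + \<epsilon> * z))"
    proof
      fix z show "F (x + \<epsilon> * z) = w z * G (x + \<epsilon> * z)"
        using \<open>\<epsilon> > 0\<close> by (simp add: F_def field_simps)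
    qed
    finally show ?thesis
      using \<open>\<epsilon> > 0\<close> unfolding set_lebesgue_integral_def real_scaleR_def F_eq by simp
  qed
  have odd_vanishes: "(LINT z|lebesgue. w z * P (\<epsilon> * z)) = 0"
  proof -
    have "(\<lambda>z. P (\<epsilon> * z)) \<in> borel_measurable borel" by measurable
    then have [measurable]: "(\<lambda>z. P (\<epsilon> * z)) \<in> borel_measurable lebesgue"
      by (intro measurable_completion) auto
    have "(LINT z|lebesgue. w z * P (\<epsilon> * z))
        = \<bar>-1\<bar> * (LINT z|lebesgue. w (0 + (-1) * z) * P (\<epsilon> * (0 + (-1) * z)))"
      by (rule lebesgue_integral_real_affine[of "\<lambda>z. w z * P (\<epsilon> * z)"]) auto
    also have "\<dots> = - (LINT z|lebesgue. w z * P (\<epsilon> * z))"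
      by (simp add: w_even odd)
    finally show ?thesis by simp
  qed
  define R where "R z = G (x + \<epsilon> * z) - P (\<epsilon> * z) - c / 2 * \<bar>\<epsilon> * z\<bar>" for z
  have R_meas: "R \<in> borel_measurable borel" unfolding R_def by measurable
  have R_bound: "\<bar>R z\<bar> \<le> B" if "z \<in> {-1..1}" for z
    using approx[OF scale[OF that]] by (simp add: R_def)
  have int_R: "integrable lebesgue (\<lambda>z. w z * R z)"
    by (rule w_integrable[OF R_meas R_bound])
  have int_P: "integrable lebesgue (\<lambda>z. w z * P (\<epsilon> * z))"
    by (rule w_integrable[where A = N]) (use P_bound scale in auto)
  have int_abs: "integrable lebesgue (\<lambda>z. w z * \<bar>z\<bar>)"
    by (rule w_integrable[where A = 1]) auto
  have "(LINT z|lebesgue. w z * G (x + \<epsilon> * z))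
      = (LINT z|lebesgue. (w z * R z + w z * P (\<epsilon> * z)) + (c / 2 * \<epsilon>) * (w z * \<bar>z\<bar>))"
    using \<open>\<epsilon> > 0\<close> by (intro Bochner_Integration.integral_cong) (auto simp: R_def abs_mult algebra_simps)
  also have "\<dots> = (LINT z|lebesgue. w z * R z) + c / 2 * \<epsilon> * (LINT z|lebesgue. w z * \<bar>z\<bar>)"
    using int_R int_P int_abs odd_vanishes by simp
  finally have split: "2 / \<epsilon>\<^sup>2 * (\<epsilon> * (LINT z|lebesgue. w z * G (x + \<epsilon> * z)))
      - c * (LINT z|lebesgue. w z * \<bar>z\<bar>) = 2 / \<epsilon> * (LINT z|lebesgue. w z * R z)"
    using \<open>\<epsilon> > 0\<close> by (simp add: field_simps power2_eq_square)
  have "\<bar>LINT z|lebesgue. w z * R z\<bar> \<le> (LINT z|lebesgue. \<bar>w z * R z\<bar>)"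
    using Bochner_Integration.integral_norm_bound[of lebesgue "\<lambda>z. w z * R z"] by simp
  also have "\<dots> \<le> (LINT z|lebesgue. (M * B) * indicator {-1..1::real} z)"
  proof (rule Bochner_Integration.integral_mono)
    show "integrable lebesgue (\<lambda>z. \<bar>w z * R z\<bar>)" using int_R by simp
    show "integrable lebesgue (\<lambda>z::real. (M * B) * indicator {-1..1} z)" by simp
    fix z :: real
    show "\<bar>w z * R z\<bar> \<le> (M * B) * indicator {-1..1} z"
    proof (cases "z \<in> {-1..1}")
      case True
      then have "\<bar>w z\<bar> * \<bar>R z\<bar> \<le> M * B"
        using w_bound[of z] R_bound[OF True] by (intro mult_mono) auto
      then show ?thesis using True by (simp add: abs_mult)
    qed (simp add: w_def)
  qed
  also have "\<dots> = 2 * (M * B)" by simp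
  finally have R_int: "\<bar>LINT z|lebesgue. w z * R z\<bar> \<le> 2 * (M * B)" .
  have "(LINT z:{-1..1}|lebesgue. J \<bar>z\<bar> * \<bar>z\<bar>) = (LINT z|lebesgue. w z * \<bar>z\<bar>)"
    unfolding set_lebesgue_integral_def w_def by (simp add: mult.assoc)
  then have "\<bar>2 / \<epsilon>\<^sup>2 * (LINT y:{x - \<epsilon>..x + \<epsilon>}|lebesgue. J (\<bar>y - x\<bar> / \<epsilon>) * G y)
      - c * (LINT z:{-1..1}|lebesgue. J \<bar>z\<bar> * \<bar>z\<bar>)\<bar> = 2 / \<epsilon> * \<bar>LINT z|lebesgue. w z * R z\<bar>"
    unfolding substitution using split \<open>\<epsilon> > 0\<close> by (simp add: abs_mult)
  also have "\<dots> \<le> 2 / \<epsilon> * (2 * (M * B))"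
    using R_int \<open>\<epsilon> > 0\<close> by (intro mult_left_mono) auto
  finally show ?thesis by simp
qed

section \<open>Linearization of the bond force\<close>

text \<open>The mean value theorem yields interior points, so a bound of \<open>g2\<close> on the open half-line suffices.\<close>

lemma second_order_taylor_on_halfline:
  fixes g g1 g2 :: "real \<Rightarrow> real"
  assumes d1: "\<And>r. r \<ge> 0 \<Longrightarrow> (g has_real_derivative g1 r) (at r within {0..})"
    and d2: "\<And>r. r \<ge> 0 \<Longrightarrow> (g1 has_real_derivative g2 r) (at r within {0..})"
    and bound: "\<And>r. r > 0 \<Longrightarrow> \<bar>g2 r\<bar> \<le> F"
    and "r \<ge> 0"
  shows "\<bar>g r - g 0 - g1 0 * r\<bar> \<le> F * r\<^sup>2"
proof (cases "r = 0")
  case False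
  then have "r > 0" using \<open>r \<ge> 0\<close> by simp
  have mv: "\<exists>t. 0 < t \<and> t < s \<and> G s - G 0 = G1 t * s"
    if "s > 0" and der: "\<And>r. r \<ge> 0 \<Longrightarrow> (G has_real_derivative G1 r) (at r within {0..})"
    for s and G G1 :: "real \<Rightarrow> real"
  proof -
    have "\<exists>t\<in>{0<..<s}. G s - G 0 = G1 t * (s - 0)"
    proof (rule mvt_simple[OF \<open>s > 0\<close>, where f' = "\<lambda>x. (*) (G1 x)"])
      fix x assume "0 \<le> x" "x \<le> s"
      then have "(G has_real_derivative G1 x) (at x within {0..s})"
        by (intro DERIV_subset[OF der]) auto
      then show "(G has_derivative (*) (G1 x)) (at x within {0..s})"
        unfolding has_field_derivative_def .
    qed
    then show ?thesis by auto
  qed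
  obtain t where t: "0 < t" "t < r" "g r - g 0 = g1 t * r"
    using mv[OF \<open>r > 0\<close> d1] by blast
  obtain t' where t': "0 < t'" "g1 t - g1 0 = g2 t' * t"
    using mv[OF \<open>0 < t\<close> d2] by blast
  have "g r - g 0 - g1 0 * r = (g1 t - g1 0) * r" using t(3) by (simp add: algebra_simps)
  also have "\<dots> = g2 t' * (t * r)" using t' by simp
  also have "\<bar>\<dots>\<bar> \<le> F * (r * r)"
    unfolding abs_mult using bound[OF t'(1)] t by (intro mult_mono) auto
  finally show ?thesis by (simp add: power2_eq_square)
qed simp

text \<open>Here \<open>S\<close> is the strain and \<open>\<eta>\<close> the contribution of interpolation to it. Three replacements are made:
  \<open>f'\<close> by its linearization at \<open>0\<close>, the cube of \<open>S\<close> by the cube of its leading part \<open>d1 * (s / \<bar>s\<bar>)\<close>,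
  and, in the linear term, \<open>S\<close> by its expansion. The second one needs the one-term expansion \<open>S1\<close>
  besides \<open>S2\<close>: its error is linear in \<open>\<bar>s\<bar>\<close> for all \<open>s\<close>, whereas \<open>S2\<close> would contribute a term of
  order \<open>\<bar>s\<bar>\<^sup>3\<close>, which is not dominated by \<open>s\<^sup>2\<close> when the horizon is large.\<close>

lemma bond_force_expansion:
  fixes f' :: "real \<Rightarrow> real" and s S :: real
  assumes f': "\<And>r. r \<ge> 0 \<Longrightarrow> \<bar>f' r - f' 0 - f2 * r\<bar> \<le> F * r\<^sup>2"
    and S0: "\<bar>S\<bar> \<le> B" and d1: "\<bar>d1\<bar> \<le> B"
    and S1: "\<bar>S - d1 * (s / \<bar>s\<bar>)\<bar> \<le> L1 * \<bar>s\<bar> + \<eta>"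
    and S2: "\<bar>S - d1 * (s / \<bar>s\<bar>) - d2 / 2 * \<bar>s\<bar>\<bar> \<le> L2 * s\<^sup>2 + \<eta>"
    and \<eta>: "0 \<le> \<eta>" "\<eta> \<le> E"
  shows "\<bar>f' (\<bar>s\<bar> * S\<^sup>2) * S - (f' 0 * d1 * (s / \<bar>s\<bar>) + f2 * d1 ^ 3 * s) - f' 0 * d2 / 2 * \<bar>s\<bar>\<bar>
    \<le> (F * B ^ 5 + 3 * \<bar>f2\<bar> * B\<^sup>2 * (L1 + 1) + \<bar>f' 0\<bar> * L2) * s\<^sup>2
      + (3 * \<bar>f2\<bar> * B\<^sup>2 * E + \<bar>f' 0\<bar>) * \<eta>"
proof -
  define \<tau> where "\<tau> = d1 * (s / \<bar>s\<bar>)"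
  have \<tau>: "\<bar>\<tau>\<bar> \<le> B" using d1 S0 by (cases "s = 0") (auto simp: \<tau>_def abs_mult)
  have "B \<ge> 0" using d1 by linarith
  have "F \<ge> 0" using f'[of 1] by auto
  have \<tau>3: "\<bar>s\<bar> * \<tau> ^ 3 = d1 ^ 3 * s"
    by (cases "s > 0"; cases "s < 0") (auto simp: \<tau>_def power3_eq_cube)
  have cubic: "\<bar>f' (\<bar>s\<bar> * S\<^sup>2) * S - f' 0 * S - f2 * \<bar>s\<bar> * S ^ 3\<bar> \<le> F * B ^ 5 * s\<^sup>2"
  proof -
    have "\<bar>f' (\<bar>s\<bar> * S\<^sup>2) - f' 0 - f2 * (\<bar>s\<bar> * S\<^sup>2)\<bar> * \<bar>S\<bar> \<le> F * (\<bar>s\<bar> * S\<^sup>2)\<^sup>2 * \<bar>S\<bar>"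
      by (intro mult_right_mono f') auto
    also have "\<dots> = F * s\<^sup>2 * \<bar>S\<bar> ^ 5"
    proof -
      have "(\<bar>s\<bar> * S\<^sup>2)\<^sup>2 = s\<^sup>2 * \<bar>S\<bar> ^ 4" by (simp add: power_mult_distrib flip: power_mult)
      moreover have "\<bar>S\<bar> ^ 5 = \<bar>S\<bar> ^ 4 * \<bar>S\<bar>" by (simp add: power_numeral_even eval_nat_numeral)
      ultimately show ?thesis by simp
    qed
    also have "\<dots> \<le> F * s\<^sup>2 * B ^ 5"
      using S0 \<open>F \<ge> 0\<close> by (intro mult_left_mono power_mono) auto
    finally show ?thesis
      unfolding abs_mult[symmetric] by (simp add: algebra_simps power3_eq_cube power2_eq_square)
  qed
  have cube_diff: "\<bar>S ^ 3 - \<tau> ^ 3\<bar> \<le> 3 * B\<^sup>2 * (L1 * \<bar>s\<bar> + \<eta>)"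
  proof -
    have "S ^ 3 - \<tau> ^ 3 = (S\<^sup>2 + S * \<tau> + \<tau>\<^sup>2) * (S - \<tau>)"
      by (simp add: algebra_simps power3_eq_cube power2_eq_square)
    moreover have "\<bar>S\<^sup>2 + S * \<tau> + \<tau>\<^sup>2\<bar> \<le> 3 * B\<^sup>2"
    proof -
      have "\<bar>S * S\<bar> \<le> B * B" "\<bar>S * \<tau>\<bar> \<le> B * B" "\<bar>\<tau> * \<tau>\<bar> \<le> B * B"
        using S0 \<tau> \<open>B \<ge> 0\<close> by (simp_all only: abs_mult mult_mono abs_ge_zero)
      then show ?thesis unfolding power2_eq_square by linarith
    qed
    ultimately show ?thesis
      using S1 unfolding \<tau>_def[symmetric] by (auto simp: abs_mult intro: mult_mono)
  qed
  have odd: "\<bar>f2 * \<bar>s\<bar> * S ^ 3 - f2 * d1 ^ 3 * s\<bar> \<le> 3 * \<bar>f2\<bar> * B\<^sup>2 * ((L1 + 1) * s\<^sup>2 + E * \<eta>)"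
  proof -
    have "f2 * \<bar>s\<bar> * S ^ 3 - f2 * d1 ^ 3 * s = f2 * \<bar>s\<bar> * (S ^ 3 - \<tau> ^ 3)"
      using \<tau>3 by (simp add: algebra_simps)
    then have "\<bar>f2 * \<bar>s\<bar> * S ^ 3 - f2 * d1 ^ 3 * s\<bar> \<le> \<bar>f2\<bar> * \<bar>s\<bar> * (3 * B\<^sup>2 * (L1 * \<bar>s\<bar> + \<eta>))"
      using cube_diff by (simp add: abs_mult mult_left_mono)
    also have "\<dots> = 3 * \<bar>f2\<bar> * B\<^sup>2 * (L1 * s\<^sup>2 + \<bar>s\<bar> * \<eta>)"
      unfolding power2_abs[of s, symmetric] by (simp add: algebra_simps power2_eq_square)
    also have "\<dots> \<le> 3 * \<bar>f2\<bar> * B\<^sup>2 * ((L1 + 1) * s\<^sup>2 + E * \<eta>)"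
    proof (intro mult_left_mono)
      \<comment> \<open>the mixed term \<open>\<bar>s\<bar> * \<eta>\<close> is split so that the result is linear in \<open>\<eta>\<close>\<close>
      have "2 * (\<bar>s\<bar> * \<eta>) \<le> s\<^sup>2 + \<eta>\<^sup>2"
        using sum_squares_bound[of "\<bar>s\<bar>" \<eta>] by simp
      moreover have "\<eta>\<^sup>2 \<le> E * \<eta>" using \<eta> by (simp add: power2_eq_square mult_right_mono)
      moreover have "0 \<le> E * \<eta>" using \<eta> by simp
      ultimately show "L1 * s\<^sup>2 + \<bar>s\<bar> * \<eta> \<le> (L1 + 1) * s\<^sup>2 + E * \<eta>"
        using zero_le_power2[of s] unfolding distrib_right by linarith
    qed auto
    finally show ?thesis .
  qed
  have linear: "\<bar>f' 0 * S - f' 0 * d1 * (s / \<bar>s\<bar>) - f' 0 * d2 / 2 * \<bar>s\<bar>\<bar> \<le> \<bar>f' 0\<bar> * (L2 * s\<^sup>2 + \<eta>)"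
  proof -
    have "f' 0 * S - f' 0 * d1 * (s / \<bar>s\<bar>) - f' 0 * d2 / 2 * \<bar>s\<bar>
        = f' 0 * (S - d1 * (s / \<bar>s\<bar>) - d2 / 2 * \<bar>s\<bar>)"
      by (simp add: algebra_simps)
    then show ?thesis using S2 by (simp add: abs_mult mult_left_mono)
  qed
  \<comment> \<open>stated for variables, so that the absolute values inside the terms are not split into cases\<close>
  have triangle: "\<bar>w - (\<alpha> + \<beta>) - \<gamma>\<bar> \<le> X + Y + Z"
    if "\<bar>w - \<phi> - \<psi>\<bar> \<le> X" "\<bar>\<psi> - \<beta>\<bar> \<le> Y" "\<bar>\<phi> - \<alpha> - \<gamma>\<bar> \<le> Z"
    for w \<alpha> \<beta> \<gamma> \<phi> \<psi> X Y Z :: real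
    using that by linarith
  have "\<bar>f' (\<bar>s\<bar> * S\<^sup>2) * S - (f' 0 * d1 * (s / \<bar>s\<bar>) + f2 * d1 ^ 3 * s) - f' 0 * d2 / 2 * \<bar>s\<bar>\<bar>
    \<le> F * B ^ 5 * s\<^sup>2 + 3 * \<bar>f2\<bar> * B\<^sup>2 * ((L1 + 1) * s\<^sup>2 + E * \<eta>) + \<bar>f' 0\<bar> * (L2 * s\<^sup>2 + \<eta>)"
    by (rule triangle[OF cubic odd linear])
  also have "\<dots> = (F * B ^ 5 + 3 * \<bar>f2\<bar> * B\<^sup>2 * (L1 + 1) + \<bar>f' 0\<bar> * L2) * s\<^sup>2
      + (3 * \<bar>f2\<bar> * B\<^sup>2 * E + \<bar>f' 0\<bar>) * \<eta>"
    by (simp add: algebra_simps)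
  finally show ?thesis .
qed

section \<open>Consistency of the peridynamic forces\<close>

text \<open>A supremum of reals over an empty set is unspecified; but \<open>a\<close> is a grid point of every admissible
  mesh.\<close>

lemma SUP_grid_indices_rate:
  fixes g :: "real \<Rightarrow> real \<Rightarrow> int \<Rightarrow> real"
  assumes "a < b" "p \<ge> 1"
    and rate: "\<exists>C. \<forall>h \<epsilon>. admissible_mesh a b h \<epsilon> \<longrightarrow> (\<forall>i\<in>grid_indices h p a b. g h \<epsilon> i \<le> C * r h \<epsilon>)"
  shows "\<exists>C. \<forall>h \<epsilon>. admissible_mesh a b h \<epsilon> \<longrightarrow> (SUP i\<in>grid_indices h p a b. g h \<epsilon> i) \<le> C * r h \<epsilon>"
proof -
  have nonempty: "grid_indices h p a b \<noteq> {}" if mesh: "admissible_mesh a b h \<epsilon>" for h \<epsilon>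
  proof -
    obtain A B :: int where AB: "a = of_int A * h"
      using mesh_endpoints[OF \<open>a < b\<close>] mesh unfolding admissible_mesh_def by blast
    have "grid_pt h p (A * int p) = a" using \<open>p \<ge> 1\<close> AB by (simp add: grid_pt_def)
    then have "A * int p \<in> grid_indices h p a b" using \<open>a < b\<close> by (simp add: grid_indices_def)
    then show ?thesis by blast
  qed
  obtain C where C: "\<And>h \<epsilon> i. admissible_mesh a b h \<epsilon> \<Longrightarrow> i \<in> grid_indices h p a b \<Longrightarrow> g h \<epsilon> i \<le> C * r h \<epsilon>"
    using rate by blast
  show ?thesis
    by (intro exI[of _ C] allI impI cSUP_least nonempty C)
qed

text \<open>A bound for \<open>h\<close> that is independent of the mesh; it keeps powers of the interpolation error bounded
  and linear in \<open>h ^ p\<close> with uniform constants.\<close>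

lemma admissible_mesh_le:
  assumes "a < b" "admissible_mesh a b h \<epsilon>"
  shows "h \<le> b - a"
proof -
  obtain A B :: int where AB: "a = of_int A * h" "b = of_int B * h" "A < B" and "h > 0"
    using mesh_endpoints[OF \<open>a < b\<close>] assms(2) unfolding admissible_mesh_def by blast
  have "1 * h \<le> of_int (B - A) * h" using AB(3) \<open>h > 0\<close> by (intro mult_right_mono) auto
  then show ?thesis using AB by (simp add: left_diff_distrib)
qed

lemma C_on_interval_bounded:
  assumes "C_on {a..b} n u" "k \<le> n"
  obtains L where "L \<ge> 0" "\<And>x. x \<in> {a..b} \<Longrightarrow> \<bar>nth_deriv_on {a..b} k u x\<bar> \<le> L"
proof -
  have "bounded (nth_deriv_on {a..b} k u ` {a..b})"
    using C_on_continuous_on[OF assms] by (intro compact_imp_bounded compact_continuous_image) auto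
  then obtain L where "L > 0" "\<And>x. x \<in> {a..b} \<Longrightarrow> \<bar>nth_deriv_on {a..b} k u x\<bar> \<le> L"
    unfolding bounded_pos by auto
  then show ?thesis using that[of L] by auto
qed

lemma zero_ext_strain_expansion:
  assumes "a < b" "C_on {a..b} (Suc n) u" "C_on UNIV n (zero_ext a b u)"
    and bound: "\<And>x. x \<in> {a..b} \<Longrightarrow> \<bar>nth_deriv_on {a..b} (Suc n) u x\<bar> \<le> L"
    and v: "\<And>y. \<bar>v y - zero_ext a b u y\<bar> \<le> \<eta> * \<bar>y - x\<bar>" and "\<eta> \<ge> 0"
  shows "\<bar>strain v (x + s) x
      - (\<Sum>j=1..n. nth_deriv_on UNIV j (zero_ext a b u) x / fact j * (s ^ j / \<bar>s\<bar>))\<bar>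
    \<le> L * \<bar>s\<bar> ^ n + \<eta>"
proof -
  let ?d = "\<lambda>j. nth_deriv_on UNIV j (zero_ext a b u)"
  have der: "(?d j has_real_derivative ?d (Suc j) t) (at t)" if "j < n" for j t
    using C_on_deriv[OF assms(3) that, of t] by simp
  have lip: "\<bar>?d n y - ?d n z\<bar> \<le> L * \<bar>y - z\<bar>" for y z
    using bound by (rule zero_ext_deriv_lipschitz[OF assms(1-3)])
  show ?thesis
    using strain_expansion[of n ?d L v x "x + s" \<eta>, OF der lip] v[of x] v[of "x + s"] \<open>\<eta> \<ge> 0\<close>
    by simp
qed

lemma interp_error:
  assumes "a < b" "p \<ge> 1" "C_on {a..b} (p + 1) u" "C_on UNIV 0 (zero_ext a b u)"
  obtains K where "K \<ge> 0"
    and "\<And>h \<epsilon> i y. admissible_mesh a b h \<epsilon> \<Longrightarrow>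
      \<bar>lagrange_interp h p (zero_ext a b u) y - zero_ext a b u y\<bar> \<le> K * h ^ p * \<bar>y - grid_pt h p i\<bar>"
proof -
  obtain K where K: "K \<ge> 0" "\<And>x. x \<in> {a..b} \<Longrightarrow> \<bar>nth_deriv_on {a..b} (p + 1) u x\<bar> \<le> K"
    using C_on_interval_bounded[OF assms(3) order_refl] by blast
  show ?thesis
  proof (rule that[OF K(1)])
    fix h \<epsilon> i y assume "admissible_mesh a b h \<epsilon>"
    then have mesh: "h > 0" "union_of_elems h (closure {a..b})" by (auto simp: admissible_mesh_def)
    have "bounded_deriv_chain (mesh_elem h k) (Suc p) K (zero_ext a b u)" for k
      using bounded_deriv_chain_zero_ext[OF \<open>a < b\<close> mesh, of "Suc p" u K k] assms(3,4) K(2) by simp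
    then show "\<bar>lagrange_interp h p (zero_ext a b u) y - zero_ext a b u y\<bar>
        \<le> K * h ^ p * \<bar>y - grid_pt h p i\<bar>"
      using lagrange_interp_error_at_grid_pt[OF mesh(1) assms(2) K(1)] by blast
  qed
qed

lemma elastic_modulus_eq:
  "elastic_modulus J f = nth_deriv_on {0..} 1 f 0 * (LINT z:{-1..1}|lebesgue. J \<bar>z\<bar> * \<bar>z\<bar>)"
  unfolding elastic_modulus_def set_integral_mult_right[symmetric]
  by (simp add: mult_ac)

lemma sum_to_2: "(\<Sum>j=1..2. g j) = g 1 + (g 2 :: real)"
  for g :: "nat \<Rightarrow> real"
  by (simp add: numeral_eq_Suc)

lemma sum_to_3: "(\<Sum>j=1..3. g j) = g 1 + g 2 + (g 3 :: real)"
  for g :: "nat \<Rightarrow> real"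
  by (simp add: numeral_eq_Suc)

text \<open>The number \<open>n\<close> of derivatives that the extension has on the line determines the order in \<open>\<epsilon>\<close>. For
  \<open>n = 3\<close> the additional term of the strain, \<open>s\<^sup>3 / \<bar>s\<bar>\<close> up to a factor, is odd, so it disappears and
  the order increases by one.\<close>

lemma pd_force_lin_consistency:
  fixes a b M :: real and J f u :: "real \<Rightarrow> real" and p n :: nat
  assumes "a < b" "p \<ge> 1" "n = 2 \<or> n = 3"
    and J_meas: "(\<lambda>\<xi>. J \<bar>\<xi>\<bar>) \<in> borel_measurable lebesgue"
    and J_bounds: "\<And>\<xi>. \<xi> \<in> {-1..1} \<Longrightarrow> 0 \<le> J \<bar>\<xi>\<bar> \<and> J \<bar>\<xi>\<bar> \<le> M"
    and reg_p: "C_on {a..b} (p + 1) u" and reg: "C_on {a..b} (Suc n) u"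
    and ext: "C_on UNIV n (zero_ext a b u)"
  shows "\<exists>C. \<forall>h \<epsilon>. admissible_mesh a b h \<epsilon> \<longrightarrow> (\<forall>i\<in>grid_indices h p a b.
      \<bar>pd_force_lin J f \<epsilon> (lagrange_interp h p (zero_ext a b u)) (grid_pt h p i)
        - elastic_modulus J f * nth_deriv_on {a..b} 2 u (grid_pt h p i)\<bar>
      \<le> C * (\<epsilon> ^ (n - 1) + h ^ p / \<epsilon>))"
proof -
  let ?U = "zero_ext a b u"
  define f0 where "f0 = nth_deriv_on {0..} 1 f 0"
  obtain K where K: "K \<ge> 0" "\<And>h \<epsilon> i y. admissible_mesh a b h \<epsilon> \<Longrightarrow>
      \<bar>lagrange_interp h p ?U y - ?U y\<bar> \<le> K * h ^ p * \<bar>y - grid_pt h p i\<bar>"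
    using interp_error[OF assms(1,2) reg_p C_on_mono[OF ext]] by blast
  obtain L where L: "L \<ge> 0" "\<And>x. x \<in> {a..b} \<Longrightarrow> \<bar>nth_deriv_on {a..b} (Suc n) u x\<bar> \<le> L"
    using C_on_interval_bounded[OF reg order_refl] by blast
  have "M \<ge> 0" using J_bounds[of 0] by simp
  show ?thesis
  proof (intro exI[of _ "4 * M * \<bar>f0\<bar> * (L + K)"] allI impI ballI)
    fix h \<epsilon> i assume mesh: "admissible_mesh a b h \<epsilon>" and i: "i \<in> grid_indices h p a b"
    define x where "x = grid_pt h p i"
    define v where "v = lagrange_interp h p ?U"
    define d where "d j = nth_deriv_on UNIV j ?U x" for j
    have x: "x \<in> {a..b}" using i by (simp add: grid_indices_def x_def)
    have "h > 0" "\<epsilon> > 0" using mesh by (auto simp: admissible_mesh_def)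
    have d2: "d 2 = nth_deriv_on {a..b} 2 u x"
      unfolding d_def using assms(3)
      by (intro zero_ext_deriv_inside[OF \<open>a < b\<close> C_on_mono[OF reg] ext _ x]) auto
    define c3 where "c3 = (if n = 3 then d 3 / 6 else 0)"
    define P where "P s = f0 * (d 1 * (s / \<bar>s\<bar>) + c3 * (s ^ 3 / \<bar>s\<bar>))" for s
    have v_meas[measurable]: "v \<in> borel_measurable borel"
      unfolding v_def by (rule lagrange_interp_borel_measurable)
    have approx: "\<bar>f0 * strain v (x + s) x - P s - f0 * d 2 / 2 * \<bar>s\<bar>\<bar> \<le> \<bar>f0\<bar> * (L * \<epsilon> ^ n + K * h ^ p)"
      if s: "\<bar>s\<bar> \<le> \<epsilon>" for s
    proof -
      have sq: "s ^ 2 / \<bar>s\<bar> = \<bar>s\<bar>"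
        by (cases "s = 0") (auto simp: field_simps power2_eq_square)
      have sum: "(\<Sum>j=1..n. d j / fact j * (s ^ j / \<bar>s\<bar>))
          = d 1 * (s / \<bar>s\<bar>) + d 2 / 2 * \<bar>s\<bar> + c3 * (s ^ 3 / \<bar>s\<bar>)"
        using assms(3)
      proof
        assume "n = 2"
        then show ?thesis by (simp only: sum_to_2 sq c3_def) simp
      next
        assume "n = 3"
        then show ?thesis by (simp only: sum_to_3 sq c3_def) (simp add: fact_numeral)
      qed
      have "\<bar>strain v (x + s) x - (\<Sum>j=1..n. d j / fact j * (s ^ j / \<bar>s\<bar>))\<bar> \<le> L * \<bar>s\<bar> ^ n + K * h ^ p"
        unfolding d_def
        using zero_ext_strain_expansion[OF \<open>a < b\<close> reg ext L(2), of v "K * h ^ p" x s]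
          K(2)[OF mesh] K(1) \<open>h > 0\<close> by (simp add: v_def x_def)
      also have "\<dots> \<le> L * \<epsilon> ^ n + K * h ^ p"
        using s L(1) by (intro add_right_mono mult_left_mono power_mono) auto
      finally have "\<bar>f0\<bar> * \<bar>strain v (x + s) x - (\<Sum>j=1..n. d j / fact j * (s ^ j / \<bar>s\<bar>))\<bar>
          \<le> \<bar>f0\<bar> * (L * \<epsilon> ^ n + K * h ^ p)"
        by (intro mult_left_mono) auto
      then show ?thesis
        unfolding abs_mult[symmetric] sum P_def by (simp add: algebra_simps)
    qed
    have P_bound: "\<bar>P s\<bar> \<le> \<bar>f0\<bar> * (\<bar>d 1\<bar> + \<bar>c3\<bar> * \<epsilon>\<^sup>2)" if s: "\<bar>s\<bar> \<le> \<epsilon>" for s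
    proof -
      have "\<bar>s ^ 3 / \<bar>s\<bar>\<bar> = \<bar>s\<bar> ^ 2" "\<bar>s / \<bar>s\<bar>\<bar> \<le> 1"
        by (cases "s = 0"; simp add: power_abs power3_eq_cube power2_eq_square abs_mult)+
      moreover have "\<bar>s\<bar> ^ 2 \<le> \<epsilon>\<^sup>2" using s by (intro power_mono) auto
      ultimately have "\<bar>d 1 * (s / \<bar>s\<bar>)\<bar> \<le> \<bar>d 1\<bar> * 1" "\<bar>c3 * (s ^ 3 / \<bar>s\<bar>)\<bar> \<le> \<bar>c3\<bar> * \<epsilon>\<^sup>2"
        unfolding abs_mult by (auto intro!: mult_left_mono)
      then have "\<bar>d 1 * (s / \<bar>s\<bar>) + c3 * (s ^ 3 / \<bar>s\<bar>)\<bar> \<le> \<bar>d 1\<bar> + \<bar>c3\<bar> * \<epsilon>\<^sup>2"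
        by (intro order_trans[OF abs_triangle_ineq] add_mono) auto
      then show ?thesis unfolding P_def abs_mult[of f0] by (intro mult_left_mono) auto
    qed
    have "\<bar>2 / \<epsilon>\<^sup>2 * (LINT y:{x - \<epsilon>..x + \<epsilon>}|lebesgue. J (\<bar>y - x\<bar> / \<epsilon>) * (f0 * strain v y x))
        - (f0 * d 2) * (LINT z:{-1..1}|lebesgue. J \<bar>z\<bar> * \<bar>z\<bar>)\<bar>
      \<le> 4 * M * (\<bar>f0\<bar> * (L * \<epsilon> ^ n + K * h ^ p)) / \<epsilon>"
    proof (rule kernel_average_error[OF J_meas J_bounds \<open>\<epsilon> > 0\<close>])
      show "(\<lambda>y. f0 * strain v y x) \<in> borel_measurable borel"
        unfolding strain_def by measurable
      show "P \<in> borel_measurable borel" unfolding P_def by measurable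
      show "P (- s) = - P s" for s unfolding P_def by (simp add: algebra_simps)
    qed (use approx P_bound in auto)
    also have "\<dots> = 4 * M * \<bar>f0\<bar> * (L * \<epsilon> ^ (n - 1) + K * (h ^ p / \<epsilon>))"
    proof -
      have "\<epsilon> ^ n = \<epsilon> ^ (n - 1) * \<epsilon>" using assms(3) by (auto simp: numeral_eq_Suc)
      then show ?thesis using \<open>\<epsilon> > 0\<close> by (simp add: field_simps)
    qed
    also have "\<dots> \<le> 4 * M * \<bar>f0\<bar> * ((L + K) * (\<epsilon> ^ (n - 1) + h ^ p / \<epsilon>))"
    proof (rule mult_left_mono)
      have "0 \<le> L * (h ^ p / \<epsilon>)" "0 \<le> K * \<epsilon> ^ (n - 1)"
        using L(1) K(1) \<open>h > 0\<close> \<open>\<epsilon> > 0\<close> by auto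
      then show "L * \<epsilon> ^ (n - 1) + K * (h ^ p / \<epsilon>) \<le> (L + K) * (\<epsilon> ^ (n - 1) + h ^ p / \<epsilon>)"
        unfolding distrib_left distrib_right by linarith
    qed (use \<open>M \<ge> 0\<close> in auto)
    finally show "\<bar>pd_force_lin J f \<epsilon> (lagrange_interp h p ?U) (grid_pt h p i)
        - elastic_modulus J f * nth_deriv_on {a..b} 2 u (grid_pt h p i)\<bar>
      \<le> 4 * M * \<bar>f0\<bar> * (L + K) * (\<epsilon> ^ (n - 1) + h ^ p / \<epsilon>)"
      unfolding pd_force_lin_def elastic_modulus_eq x_def[symmetric] v_def[symmetric]
        f0_def[symmetric] d2[symmetric] by (simp only: mult_ac)
  qed
qed

text \<open>The strain is expanded to zero, one and two terms, with the bounds \<open>L0\<close>, \<open>L1\<close>, \<open>L2\<close> of the first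
  three derivatives of \<open>u\<close>; the expansion to zero terms is the bound of the strain.\<close>

lemma pd_force_consistency:
  fixes a b M :: real and J f u :: "real \<Rightarrow> real" and p :: nat
  assumes "a < b" "p \<ge> 1"
    and f_smooth: "C_on {0..} 3 f"
    and f3_bounded: "bounded (nth_deriv_on {0..} 3 f ` {0<..})"
    and J_meas: "(\<lambda>\<xi>. J \<bar>\<xi>\<bar>) \<in> borel_measurable lebesgue"
    and J_bounds: "\<And>\<xi>. \<xi> \<in> {-1..1} \<Longrightarrow> 0 \<le> J \<bar>\<xi>\<bar> \<and> J \<bar>\<xi>\<bar> \<le> M"
    and reg_p: "C_on {a..b} (p + 1) u" and reg: "C_on {a..b} 3 u"
    and ext: "C_on UNIV 2 (zero_ext a b u)"
  shows "\<exists>C. \<forall>h \<epsilon>. admissible_mesh a b h \<epsilon> \<longrightarrow> (\<forall>i\<in>grid_indices h p a b.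
      \<bar>pd_force J f \<epsilon> (lagrange_interp h p (zero_ext a b u)) (grid_pt h p i)
        - elastic_modulus J f * nth_deriv_on {a..b} 2 u (grid_pt h p i)\<bar>
      \<le> C * (\<epsilon> + h ^ p / \<epsilon>))"
proof -
  let ?U = "zero_ext a b u"
  define f' where "f' = nth_deriv_on {0..} 1 f"
  define f2 where "f2 = nth_deriv_on {0..} 2 f 0"
  obtain F where F: "F > 0" "\<And>r. r > 0 \<Longrightarrow> \<bar>nth_deriv_on {0..} 3 f r\<bar> \<le> F"
    using f3_bounded unfolding bounded_pos by auto
  have f'_taylor: "\<bar>f' r - f' 0 - f2 * r\<bar> \<le> F * r\<^sup>2" if "r \<ge> 0" for r
    unfolding f'_def f2_def
    by (rule second_order_taylor_on_halfline[where ?g2.0 = "nth_deriv_on {0..} 3 f"])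
       (use C_on_deriv[OF f_smooth, of 1] C_on_deriv[OF f_smooth, of 2] F that
        in \<open>auto simp: numeral_eq_Suc\<close>)
  \<comment> \<open>\<open>f'\<close> is continuous on \<open>[0,\<infinity>)\<close> only and arbitrary on negative numbers\<close>
  have f'_meas: "(\<lambda>r. f' (max 0 r)) \<in> borel_measurable borel"
    unfolding f'_def
    by (intro borel_measurable_continuous_onI continuous_on_compose2[OF C_on_continuous_on[OF f_smooth]])
       (auto intro!: continuous_intros)
  obtain K where K: "K \<ge> 0" "\<And>h \<epsilon> i y. admissible_mesh a b h \<epsilon> \<Longrightarrow>
      \<bar>lagrange_interp h p ?U y - ?U y\<bar> \<le> K * h ^ p * \<bar>y - grid_pt h p i\<bar>"
    using interp_error[OF assms(1,2) reg_p C_on_mono[OF ext]] by blast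
  obtain L0 where L0: "L0 \<ge> 0" "\<And>x. x \<in> {a..b} \<Longrightarrow> \<bar>nth_deriv_on {a..b} (Suc 0) u x\<bar> \<le> L0"
    using C_on_interval_bounded[OF reg, of "Suc 0"] by auto
  obtain L1 where L1: "L1 \<ge> 0" "\<And>x. x \<in> {a..b} \<Longrightarrow> \<bar>nth_deriv_on {a..b} (Suc 1) u x\<bar> \<le> L1"
    using C_on_interval_bounded[OF reg, of "Suc 1"] by auto
  obtain L2 where L2: "L2 \<ge> 0" "\<And>x. x \<in> {a..b} \<Longrightarrow> \<bar>nth_deriv_on {a..b} (Suc 2) u x\<bar> \<le> L2"
    using C_on_interval_bounded[OF reg, of "Suc 2"] by auto
  have "M \<ge> 0" using J_bounds[of 0] by simp
  define E where "E = K * (b - a) ^ p"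
  have "E \<ge> 0" using K(1) \<open>a < b\<close> by (simp add: E_def)
  define A1 where "A1 = F * (L0 + E) ^ 5 + 3 * \<bar>f2\<bar> * (L0 + E)\<^sup>2 * (L1 + 1) + \<bar>f' 0\<bar> * L2"
  define A2 where "A2 = (3 * \<bar>f2\<bar> * (L0 + E)\<^sup>2 * E + \<bar>f' 0\<bar>) * K"
  have A1: "A1 \<ge> 0" and A2: "A2 \<ge> 0"
    using F(1) L0(1) L1(1) L2(1) K(1) \<open>E \<ge> 0\<close> by (auto simp: A1_def A2_def)
  show ?thesis
  proof (intro exI[of _ "4 * M * (A1 + A2)"] allI impI ballI)
    fix h \<epsilon> i assume mesh: "admissible_mesh a b h \<epsilon>" and i: "i \<in> grid_indices h p a b"
    define x where "x = grid_pt h p i"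
    define v where "v = lagrange_interp h p ?U"
    define d where "d j = nth_deriv_on UNIV j ?U x" for j
    have x: "x \<in> {a..b}" using i by (simp add: grid_indices_def x_def)
    have "h > 0" "\<epsilon> > 0" using mesh by (auto simp: admissible_mesh_def)
    have d_eq: "d j = nth_deriv_on {a..b} j u x" if "j \<le> 2" for j
      unfolding d_def using that
      by (intro zero_ext_deriv_inside[OF \<open>a < b\<close> C_on_mono[OF reg] ext _ x]) auto
    \<comment> \<open>the slope of the interpolation error seen from \<open>x\<close>, at most \<open>E\<close> for every admissible mesh\<close>
    define \<eta> where "\<eta> = K * h ^ p"
    have \<eta>: "0 \<le> \<eta>" "\<eta> \<le> E"
      using K(1) \<open>h > 0\<close> admissible_mesh_le[OF \<open>a < b\<close> mesh]
      by (auto simp: \<eta>_def E_def intro!: mult_left_mono power_mono)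
    have v_error: "\<bar>v y - ?U y\<bar> \<le> \<eta> * \<bar>y - x\<bar>" for y
      using K(2)[OF mesh] by (simp add: v_def x_def \<eta>_def)
    have expansion: "\<bar>strain v (x + s) x - (\<Sum>j=1..n. d j / fact j * (s ^ j / \<bar>s\<bar>))\<bar> \<le> L * \<bar>s\<bar> ^ n + \<eta>"
      if "n \<le> 2" "\<And>x. x \<in> {a..b} \<Longrightarrow> \<bar>nth_deriv_on {a..b} (Suc n) u x\<bar> \<le> L" for n L s
      unfolding d_def using that(1)
      by (intro zero_ext_strain_expansion[OF \<open>a < b\<close> C_on_mono[OF reg] C_on_mono[OF ext] that(2)
            v_error \<eta>(1)]) auto
    define G where "G y = f' (\<bar>y - x\<bar> * (strain v y x)\<^sup>2) * strain v y x" for y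
    define P where "P s = f' 0 * d 1 * (s / \<bar>s\<bar>) + f2 * d 1 ^ 3 * s" for s
    have approx: "\<bar>G (x + s) - P s - f' 0 * d 2 / 2 * \<bar>s\<bar>\<bar> \<le> A1 * \<epsilon>\<^sup>2 + A2 * h ^ p"
      if s: "\<bar>s\<bar> \<le> \<epsilon>" for s
    proof -
      have sq: "s ^ 2 / \<bar>s\<bar> = \<bar>s\<bar>"
        by (cases "s = 0") (auto simp: field_simps power2_eq_square)
      have "\<bar>G (x + s) - P s - f' 0 * d 2 / 2 * \<bar>s\<bar>\<bar>
          \<le> (F * (L0 + E) ^ 5 + 3 * \<bar>f2\<bar> * (L0 + E)\<^sup>2 * (L1 + 1) + \<bar>f' 0\<bar> * L2) * s\<^sup>2
            + (3 * \<bar>f2\<bar> * (L0 + E)\<^sup>2 * E + \<bar>f' 0\<bar>) * \<eta>"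
        unfolding G_def P_def add_diff_cancel_left'
      proof (rule bond_force_expansion[OF f'_taylor _ _ _ _ \<eta>])
        show "\<bar>strain v (x + s) x\<bar> \<le> L0 + E"
          using expansion[OF _ L0(2), of s] \<eta>(2) by simp
        show "\<bar>d 1\<bar> \<le> L0 + E"
          using L0(2)[OF x] \<open>E \<ge> 0\<close> d_eq[of 1] by simp
        show "\<bar>strain v (x + s) x - d 1 * (s / \<bar>s\<bar>)\<bar> \<le> L1 * \<bar>s\<bar> + \<eta>"
          using expansion[OF _ L1(2), of s] by simp
        show "\<bar>strain v (x + s) x - d 1 * (s / \<bar>s\<bar>) - d 2 / 2 * \<bar>s\<bar>\<bar> \<le> L2 * s\<^sup>2 + \<eta>"
          using expansion[OF _ L2(2), of s] unfolding sum_to_2 sq by (simp add: diff_diff_eq)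
      qed
      also have "\<dots> = A1 * s\<^sup>2 + A2 * h ^ p" by (simp add: A1_def A2_def \<eta>_def)
      also have "\<dots> \<le> A1 * \<epsilon>\<^sup>2 + A2 * h ^ p"
        using A1 s \<open>\<epsilon> > 0\<close> by (intro add_right_mono mult_left_mono) (auto simp: abs_le_square_iff[symmetric])
      finally show ?thesis .
    qed
    have P_bound: "\<bar>P s\<bar> \<le> \<bar>f' 0 * d 1\<bar> + \<bar>f2 * d 1 ^ 3\<bar> * \<epsilon>" if s: "\<bar>s\<bar> \<le> \<epsilon>" for s
    proof -
      have "\<bar>f' 0 * d 1\<bar> * \<bar>s / \<bar>s\<bar>\<bar> \<le> \<bar>f' 0 * d 1\<bar> * 1" "\<bar>f2 * d 1 ^ 3\<bar> * \<bar>s\<bar> \<le> \<bar>f2 * d 1 ^ 3\<bar> * \<epsilon>"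
        using s by (intro mult_left_mono; cases "s = 0"; simp)+
      then show ?thesis unfolding P_def abs_mult[symmetric] by linarith
    qed
    have v_meas[measurable]: "v \<in> borel_measurable borel"
      unfolding v_def by (rule lagrange_interp_borel_measurable)
    have G_meas: "G \<in> borel_measurable borel"
    proof -
      have [measurable]: "(\<lambda>y. strain v y x) \<in> borel_measurable borel"
        unfolding strain_def by measurable
      have "(\<lambda>y. f' (max 0 (\<bar>y - x\<bar> * (strain v y x)\<^sup>2)) * strain v y x) \<in> borel_measurable borel"
        using measurable_compose[OF _ f'_meas, of "\<lambda>y. \<bar>y - x\<bar> * (strain v y x)\<^sup>2" borel] by measurable
      then show ?thesis unfolding G_def[abs_def] by simp
    qed
    have "\<bar>2 / \<epsilon>\<^sup>2 * (LINT y:{x - \<epsilon>..x + \<epsilon>}|lebesgue. J (\<bar>y - x\<bar> / \<epsilon>) * G y)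
        - (f' 0 * d 2) * (LINT z:{-1..1}|lebesgue. J \<bar>z\<bar> * \<bar>z\<bar>)\<bar>
      \<le> 4 * M * (A1 * \<epsilon>\<^sup>2 + A2 * h ^ p) / \<epsilon>"
    proof (rule kernel_average_error[OF J_meas J_bounds \<open>\<epsilon> > 0\<close> G_meas])
      show "P \<in> borel_measurable borel" unfolding P_def by measurable
    qed (use approx P_bound in \<open>auto simp: P_def\<close>)
    also have "\<dots> = 4 * M * (A1 * \<epsilon> + A2 * (h ^ p / \<epsilon>))"
      using \<open>\<epsilon> > 0\<close> by (simp add: field_simps power2_eq_square)
    also have "\<dots> \<le> 4 * M * ((A1 + A2) * (\<epsilon> + h ^ p / \<epsilon>))"
    proof (rule mult_left_mono)
      have "0 \<le> A1 * (h ^ p / \<epsilon>)" "0 \<le> A2 * \<epsilon>"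
        using A1 A2 \<open>h > 0\<close> \<open>\<epsilon> > 0\<close> by auto
      then show "A1 * \<epsilon> + A2 * (h ^ p / \<epsilon>) \<le> (A1 + A2) * (\<epsilon> + h ^ p / \<epsilon>)"
        unfolding distrib_left distrib_right by linarith
    qed (use \<open>M \<ge> 0\<close> in auto)
    finally show "\<bar>pd_force J f \<epsilon> (lagrange_interp h p ?U) (grid_pt h p i)
        - elastic_modulus J f * nth_deriv_on {a..b} 2 u (grid_pt h p i)\<bar>
      \<le> 4 * M * (A1 + A2) * (\<epsilon> + h ^ p / \<epsilon>)"
      unfolding pd_force_def elastic_modulus_eq x_def[symmetric] v_def[symmetric]
        f'_def[symmetric] d_eq[OF order_refl, symmetric] G_def by (simp only: mult_ac)
  qed
qed

theorem proposition5:
  fixes a b M f_inf :: real and J f :: "real \<Rightarrow> real" and p :: nat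
  assumes "a < b"
    and "p \<ge> 1"
    and f_smooth: "\<forall>n. C_on {0..} n f"
    and f_pos: "\<forall>r>0. f r > 0"
    and f_concave: "concave_on {0..} f"
    and f_lim0: "((\<lambda>r. f r / r) \<longlongrightarrow> nth_deriv_on {0..} 1 f 0) (at_right 0)"
    and f_lim_inf: "(f \<longlongrightarrow> f_inf) at_top"
    and f_bounded: "\<forall>k\<in>{2, 3, 4}. bounded (nth_deriv_on {0..} k f ` {0<..})"
    and J_meas: "(\<lambda>\<xi>. J \<bar>\<xi>\<bar>) \<in> borel_measurable lebesgue"
    and J_zero: "\<forall>\<xi>. \<xi> \<notin> {-1..1} \<longrightarrow> J \<bar>\<xi>\<bar> = 0"
    and J_bounds: "\<forall>\<xi>\<in>{-1..1}. 0 \<le> J \<bar>\<xi>\<bar> \<and> J \<bar>\<xi>\<bar> \<le> M"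
  shows
    "(\<forall>u :: real \<Rightarrow> real.
        C_on {a..b} (p + 1) u \<and> bounded (nth_deriv_on {a..b} (p + 1) u ` {a..b}) \<and>
        (p = 1 \<longrightarrow> C_on {a..b} 3 u \<and> bounded (nth_deriv_on {a..b} 3 u ` {a..b})) \<and>
        C_on UNIV 2 (zero_ext a b u) \<longrightarrow>
        (\<exists>C. \<forall>h \<epsilon>. admissible_mesh a b h \<epsilon> \<longrightarrow>
           (SUP i\<in>grid_indices h p a b.
              \<bar>pd_force_lin J f \<epsilon> (lagrange_interp h p (zero_ext a b u)) (grid_pt h p i)
               - elastic_modulus J f * nth_deriv_on {a..b} 2 u (grid_pt h p i)\<bar>)
           \<le> C * (\<epsilon> + h ^ p / \<epsilon>)) \<and>
        (\<exists>C. \<forall>h \<epsilon>. admissible_mesh a b h \<epsilon> \<longrightarrow>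
           (SUP i\<in>grid_indices h p a b.
              \<bar>pd_force J f \<epsilon> (lagrange_interp h p (zero_ext a b u)) (grid_pt h p i)
               - elastic_modulus J f * nth_deriv_on {a..b} 2 u (grid_pt h p i)\<bar>)
           \<le> C * (\<epsilon> + h ^ p / \<epsilon>))) \<and>
     (\<forall>u :: real \<Rightarrow> real.
        C_on {a..b} (max (p + 1) 4) u \<and>
        bounded (nth_deriv_on {a..b} (max (p + 1) 4) u ` {a..b}) \<and>
        C_on UNIV 3 (zero_ext a b u) \<longrightarrow>
        (\<exists>C. \<forall>h \<epsilon>. admissible_mesh a b h \<epsilon> \<longrightarrow>
           (SUP i\<in>grid_indices h p a b.
              \<bar>pd_force_lin J f \<epsilon> (lagrange_interp h p (zero_ext a b u)) (grid_pt h p i)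
               - elastic_modulus J f * nth_deriv_on {a..b} 2 u (grid_pt h p i)\<bar>)
           \<le> C * (\<epsilon>\<^sup>2 + h ^ p / \<epsilon>)))"
proof (intro conjI allI impI; (elim conjE)?)
  fix u :: "real \<Rightarrow> real"
  assume reg_p: "C_on {a..b} (p + 1) u"
    and reg_1: "p = 1 \<longrightarrow> C_on {a..b} 3 u \<and> bounded (nth_deriv_on {a..b} 3 u ` {a..b})"
    and ext: "C_on UNIV 2 (zero_ext a b u)"
  have reg: "C_on {a..b} 3 u"
    using reg_1 C_on_mono[OF reg_p, of 3] \<open>p \<ge> 1\<close> by (cases "p = 1") auto
  show "\<exists>C. \<forall>h \<epsilon>. admissible_mesh a b h \<epsilon> \<longrightarrow>
      (SUP i\<in>grid_indices h p a b.
        \<bar>pd_force_lin J f \<epsilon> (lagrange_interp h p (zero_ext a b u)) (grid_pt h p i)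
         - elastic_modulus J f * nth_deriv_on {a..b} 2 u (grid_pt h p i)\<bar>) \<le> C * (\<epsilon> + h ^ p / \<epsilon>)"
    using pd_force_lin_consistency[of a b p 2 J M u f] assms(1,2) J_meas J_bounds reg_p reg ext
    by (intro SUP_grid_indices_rate[OF assms(1,2)]) simp
  show "\<exists>C. \<forall>h \<epsilon>. admissible_mesh a b h \<epsilon> \<longrightarrow>
      (SUP i\<in>grid_indices h p a b.
        \<bar>pd_force J f \<epsilon> (lagrange_interp h p (zero_ext a b u)) (grid_pt h p i)
         - elastic_modulus J f * nth_deriv_on {a..b} 2 u (grid_pt h p i)\<bar>) \<le> C * (\<epsilon> + h ^ p / \<epsilon>)"
    using pd_force_consistency[of a b p f J M u] assms(1,2) f_smooth f_bounded J_meas J_bounds reg_p reg ext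
    by (intro SUP_grid_indices_rate[OF assms(1,2)]) simp
next
  fix u :: "real \<Rightarrow> real"
  assume reg_max: "C_on {a..b} (max (p + 1) 4) u" and ext: "C_on UNIV 3 (zero_ext a b u)"
  have reg_p: "C_on {a..b} (p + 1) u" and reg: "C_on {a..b} 4 u"
    using C_on_mono[OF reg_max] by auto
  show "\<exists>C. \<forall>h \<epsilon>. admissible_mesh a b h \<epsilon> \<longrightarrow>
      (SUP i\<in>grid_indices h p a b.
        \<bar>pd_force_lin J f \<epsilon> (lagrange_interp h p (zero_ext a b u)) (grid_pt h p i)
         - elastic_modulus J f * nth_deriv_on {a..b} 2 u (grid_pt h p i)\<bar>) \<le> C * (\<epsilon>\<^sup>2 + h ^ p / \<epsilon>)"
    using pd_force_lin_consistency[of a b p 3 J M u f] assms(1,2) J_meas J_bounds reg_p reg ext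
    by (intro SUP_grid_indices_rate[OF assms(1,2)]) simp
qed

end
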